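(* Let $n\ge 1$. \begin{enumerate} \item If $n$ is odd, then every $n$-ary $\mathbb{Z}_2^2$-linear quasigroup and every $n$-ary $\mathbb{Z}_4$-linear quasigroup has exactly $\frac{3}{8}\cdot 24^{n-1}+5\cdot 8^{n-2}$ transversals. \item If $n$ is even, then every $n$-ary $\mathbb{Z}_2^2$-linear quasigroup has exactly $\frac{3}{8}\cdot 24^{n-1}-8^{n-2}$ transversals. \end{enumerate} Moreover, these quasigroups have the maximum number of transversals among all $n$-ary semilinear quasigroups, and they are unique up to isotopy and parastrophy with this property: every $n$-ary semilinear quasigroup attaining this maximum is obtained by isotopy and parastrophy from the $n$-ary iterated group $\mathbb{Z}_2^2$ or, when $n$ is odd, from the $n$-ary iterated group $\mathbb{Z}_4$.
   Context: Let $\Sigma_4=\{0,1,2,3\}$. An $n$-ary quasigroup of order $4$ is a map $f:\Sigma_4^n\to\Sigma_4$ such that the equation $x_0=f(x_1,\dots,x_n)$ has a unique solution in any one of the variables $x_0,\dots,x_n$ when the other $n$ are fixed arbitrarily. A transversal in $f$ is a set of $4$ vectors $\alpha^i=(a^i_0,\dots,a^i_n)\in\Sigma_4^{n+1}$ with $a^i_0=f(a^i_1,\dots,a^i_n)$ for all $i$ and $a^i_k\ne a^j_k$ for all $i\ne j$ and all $k\in\{0,\dots,n\}$. Quasigroups $f,g$ are isotopic if there are permutations $\sigma_0,\dots,\sigma_n$ of $\Sigma_4$ with $f(x_1,\dots,x_n)=\sigma_0^{-1}(g(\sigma_1(x_1),\dots,\sigma_n(x_n)))$; they are parastrophic if there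 is a permutation $\pi$ of $\{0,\dots,n\}$ with $x_0=f(x_1,\dots,x_n)\iff x_{\pi(0)}=g(x_{\pi(1)},\dots,x_{\pi(n)})$. For an abelian group $G$ of order $4$ identified with $\Sigma_4$ via a bijection, the $n$-ary iterated group $G$ is the quasigroup $g$ with $x_0=g(x_1,\dots,x_n)\iff x_0+x_1+\dots+x_n=0$ in $G$. A quasigroup is $\mathbb{Z}_4$-linear (resp. $\mathbb{Z}_2^2$-linear) if it is isotopic to the $n$-ary iterated group $\mathbb{Z}_4$ (resp. $\mathbb{Z}_2^2$). Let $l:\Sigma_4\to\mathbb{Z}_2$ be given by $l(0)=l(1)=0$, $l(2)=l(3)=1$. An $n$-ary quasigroup $f$ of order $4$ is standardly semilinear if there is a Boolean function $\lambda:\mathbb{Z}_2^n\to\mathbb{Z}_2$ such that for all $x_0,\dots,x_n\in\Sigma_4$: $x_0=f(x_1,\dots,x_n)$ iff $l(x_0)+\dots+l(x_n)\equiv 0\pmod 2$ and $x_0+x_1+\dots+x_n+\lambda(l(x_1),\dots,l(x_n))\equiv 0\pmod 2$ (sums of integers). A quasigroup is semilinear if it is isotopic to a standardly semilinear quasigroup. *)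

theory Defs
  imports
    Complex_Main
    "HOL-Library.FuncSet"
    "HOL-Combinatorics.Permutations"
    "HOL-Algebra.Elementary_Groups"
    "HOL-Algebra.FiniteProduct"
begin

text \<open>
  A vector indexed by a finite set \<open>I\<close> of naturals is an extensional function on \<open>I\<close>.
  An \<open>n\<close>-ary operation takes vectors indexed by \<open>{1..n}\<close>; its values on other arguments are
  irrelevant, and no notion below depends on them.
\<close>

definition Sigma4 :: "nat set" where
  "Sigma4 = {0, 1, 2, 3}"

abbreviation vecs :: "nat set \<Rightarrow> (nat \<Rightarrow> nat) set" where
  "vecs I \<equiv> I \<rightarrow>\<^sub>E Sigma4"

text \<open>The relation \<open>x\<^sub>0 = f(x\<^sub>1, \<dots>, x\<^sub>n)\<close> on vectors indexed by \<open>{0..n}\<close>.\<close>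

definition op_graph :: "nat \<Rightarrow> ((nat \<Rightarrow> nat) \<Rightarrow> nat) \<Rightarrow> (nat \<Rightarrow> nat) \<Rightarrow> bool" where
  "op_graph n f x \<longleftrightarrow> x 0 = f (restrict x {1..n})"

definition quasigroup4 :: "nat \<Rightarrow> ((nat \<Rightarrow> nat) \<Rightarrow> nat) \<Rightarrow> bool" where
  "quasigroup4 n f \<longleftrightarrow>
     f \<in> vecs {1..n} \<rightarrow> Sigma4 \<and>
     (\<forall>k\<in>{0..n}. \<forall>x\<in>vecs {0..n}. \<exists>!y. y \<in> Sigma4 \<and> op_graph n f (x(k := y)))"

definition transversal :: "nat \<Rightarrow> ((nat \<Rightarrow> nat) \<Rightarrow> nat) \<Rightarrow> (nat \<Rightarrow> nat) set \<Rightarrow> bool" where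
  "transversal n f T \<longleftrightarrow>
     T \<subseteq> vecs {0..n} \<and> card T = 4 \<and>
     (\<forall>a\<in>T. op_graph n f a) \<and>
     (\<forall>a\<in>T. \<forall>b\<in>T. a \<noteq> b \<longrightarrow> (\<forall>k\<in>{0..n}. a k \<noteq> b k))"

definition num_transversals :: "nat \<Rightarrow> ((nat \<Rightarrow> nat) \<Rightarrow> nat) \<Rightarrow> nat" where
  "num_transversals n f = card {T. transversal n f T}"

definition isotopic ::
  "nat \<Rightarrow> ((nat \<Rightarrow> nat) \<Rightarrow> nat) \<Rightarrow> ((nat \<Rightarrow> nat) \<Rightarrow> nat) \<Rightarrow> bool" where
  "isotopic n f g \<longleftrightarrow>
     quasigroup4 n f \<and> quasigroup4 n g \<and>
     (\<exists>\<sigma> :: nat \<Rightarrow> nat \<Rightarrow> nat.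
        (\<forall>i\<in>{0..n}. \<sigma> i permutes Sigma4) \<and>
        (\<forall>x\<in>vecs {1..n}. f x = inv_into UNIV (\<sigma> 0) (g (\<lambda>i\<in>{1..n}. \<sigma> i (x i)))))"

definition parastrophic ::
  "nat \<Rightarrow> ((nat \<Rightarrow> nat) \<Rightarrow> nat) \<Rightarrow> ((nat \<Rightarrow> nat) \<Rightarrow> nat) \<Rightarrow> bool" where
  "parastrophic n f g \<longleftrightarrow>
     quasigroup4 n f \<and> quasigroup4 n g \<and>
     (\<exists>\<pi>. \<pi> permutes {0..n} \<and>
        (\<forall>x\<in>vecs {0..n}. op_graph n f x \<longleftrightarrow> op_graph n g (\<lambda>i. x (\<pi> i))))"

text \<open>
  \<open>g\<close> is the \<open>n\<close>-ary iterated group \<open>G\<close> under some identification \<open>\<phi>\<close> of \<open>Sigma4\<close>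
  with the carrier of \<open>G\<close>. The group operation is written multiplicatively in the library.
\<close>

definition iterated_group ::
  "nat \<Rightarrow> ('g, 'm) monoid_scheme \<Rightarrow> ((nat \<Rightarrow> nat) \<Rightarrow> nat) \<Rightarrow> bool" where
  "iterated_group n G g \<longleftrightarrow>
     comm_group G \<and> order G = 4 \<and> quasigroup4 n g \<and>
     (\<exists>\<phi>. bij_betw \<phi> Sigma4 (carrier G) \<and>
        (\<forall>x\<in>vecs {0..n}. op_graph n g x \<longleftrightarrow> finprod G (\<lambda>i. \<phi> (x i)) {0..n} = \<one>\<^bsub>G\<^esub>))"

abbreviation Z4 :: "int monoid" where
  "Z4 \<equiv> integer_mod_group 4"

abbreviation Z2sq :: "(int \<times> int) monoid" where
  "Z2sq \<equiv> integer_mod_group 2 \<times>\<times> integer_mod_group 2"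

definition group_linear ::
  "nat \<Rightarrow> ('g, 'm) monoid_scheme \<Rightarrow> ((nat \<Rightarrow> nat) \<Rightarrow> nat) \<Rightarrow> bool" where
  "group_linear n G f \<longleftrightarrow> (\<exists>g. iterated_group n G g \<and> isotopic n f g)"

definition obtained_from_iterated_group ::
  "nat \<Rightarrow> ('g, 'm) monoid_scheme \<Rightarrow> ((nat \<Rightarrow> nat) \<Rightarrow> nat) \<Rightarrow> bool" where
  "obtained_from_iterated_group n G f \<longleftrightarrow>
     (\<exists>g h. iterated_group n G g \<and> parastrophic n h g \<and> isotopic n f h)"

definition l_half :: "nat \<Rightarrow> nat" where
  "l_half x = (if x \<in> {2, 3} then 1 else 0)"

definition standardly_semilinear :: "nat \<Rightarrow> ((nat \<Rightarrow> nat) \<Rightarrow> nat) \<Rightarrow> bool" where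
  "standardly_semilinear n f \<longleftrightarrow>
     quasigroup4 n f \<and>
     (\<exists>bf \<in> ({1..n} \<rightarrow>\<^sub>E {0, 1}) \<rightarrow> {0, 1 :: nat}.
        \<forall>x\<in>vecs {0..n}. op_graph n f x \<longleftrightarrow>
          even (\<Sum>i=0..n. l_half (x i)) \<and>
          even ((\<Sum>i=0..n. x i) + bf (\<lambda>i\<in>{1..n}. l_half (x i))))"

definition semilinear :: "nat \<Rightarrow> ((nat \<Rightarrow> nat) \<Rightarrow> nat) \<Rightarrow> bool" where
  "semilinear n f \<longleftrightarrow> (\<exists>g. standardly_semilinear n g \<and> isotopic n f g)"

definition max_among_semilinear :: "nat \<Rightarrow> ((nat \<Rightarrow> nat) \<Rightarrow> nat) \<Rightarrow> bool" where
  "max_among_semilinear n f \<longleftrightarrow>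
     semilinear n f \<and> (\<forall>h. semilinear n h \<longrightarrow> num_transversals n h \<le> num_transversals n f)"

end

theory Submission
  imports Defs "HOL-Library.Z2" "HOL-Library.Product_Plus"
begin


text \<open>
  Encode \<open>x \<in> \<Sigma>\<^sub>4\<close> by two bits: \<open>hi x = l x\<close> and the parity \<open>lo x\<close>. Then a standardly semilinear quasigroup
  is the set of vectors with \<open>\<Sum> hi = 0\<close> and \<open>\<Sum> lo = L S\<close>, where \<open>S\<close> is the set of coordinates in \<open>{1..n}\<close>
  with \<open>hi = 1\<close>. List the four rows of a transversal so that their \<open>0\<close>-th coordinates are \<open>0, 1, 2, 3\<close>; each
  column is a permutation, i.e. its high bits form a balanced vector \<open>u\<close> of length four and its low bits one of
  four partners of \<open>u\<close>. For fixed high bits the low bits range over cosets whose sum is determined by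
  linear algebra: if the high columns are not all equal up to complement, there are \<open>4\<^sup>n / 8\<close> solutions when \<open>L\<close>
  sums to \<open>0\<close> over the four rows and none otherwise; if they are, \<open>L\<close> automatically sums to \<open>0\<close> and there are
  \<open>4\<^sup>n / 4\<close> solutions. So the number of transversals is maximal exactly when \<open>L\<close> sums to \<open>0\<close> over every
  admissible quadruple of rows, which holds for \<open>L = 0\<close> (the group \<open>\<int>\<^sub>2\<^sup>2\<close>) and, for odd \<open>n\<close>, for half the weight
  of the row (the group \<open>\<int>\<^sub>4\<close>). Conversely, the quadruples \<open>S, S\<^sup>c, T, T\<^sup>c\<close> and
  \<open>T\<^sup>c, S\<^sup>c, S + i, S + j + k\<close> with \<open>T = S + i + j + k\<close> show that \<open>L\<close> is affine up to a multiple
  \<open>c \<lfloor>|S| / 2\<rfloor>\<close>, with \<open>c = 0\<close> for even \<open>n\<close>; an affine part is absorbed by an isotopy.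
\<close>

subsection \<open>Balanced columns\<close>

declare add_bit_eq_xor [simp del] mult_bit_eq_and [simp del]

lemma bit_add_self [simp]: "a + a = 0" for a :: bit
  by (cases a) auto

type_synonym col = "bit \<times> bit \<times> bit \<times> bit"

definition ones :: col where
  "ones = (1, 1, 1, 1)"

definition bal :: "col set" where
  "bal = {(0,0,1,1), (1,1,0,0), (0,1,0,1), (1,0,1,0), (0,1,1,0), (1,0,0,1)}"

text \<open>The \<open>v\<close> for which the four pairs \<open>(u\<^sub>i, v\<^sub>i)\<close> are distinct.\<close>

definition partners :: "col \<Rightarrow> col set" where
  "partners u = bal - {u, u + ones}"

fun dot :: "col \<Rightarrow> col \<Rightarrow> bit" where
  "dot (a, b, c, d) (p, q, r, s) = a * p + b * q + c * r + d * s"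

text \<open>The columns of even weight: the eight-element space spanned by \<open>bal\<close>, in
  which every sum of partners lies.\<close>

definition even_cols :: "col set" where
  "even_cols = {w. dot ones w = 0}"

text \<open>The possible sums of \<open>n\<close> partners of \<open>t\<close>: every partner \<open>v\<close> has \<open>dot t v = 1\<close>.\<close>

definition type_coset :: "col \<Rightarrow> nat \<Rightarrow> col set" where
  "type_coset t n = {w \<in> even_cols. dot t w = of_nat n}"

section \<open>Counting sums with summands from prescribed sets\<close>

definition sum_solutions :: "nat \<Rightarrow> (nat \<Rightarrow> 'a set) \<Rightarrow> 'a \<Rightarrow> (nat \<Rightarrow> 'a::ab_group_add) set" where
  "sum_solutions n S w = {V \<in> Pi\<^sub>E {1..n} S. (\<Sum>k=1..n. V k) = w}"

lemma finite_sum_solutions: "(\<And>k. finite (S k)) \<Longrightarrow> finite (sum_solutions n S w)"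
  unfolding sum_solutions_def by (rule finite_subset[OF _ finite_PiE[of "{1..n}" S]]) auto

lemma card_sum_solutions_0: "card (sum_solutions 0 S w) = of_bool (w = 0)"
  by (auto simp: sum_solutions_def)

text \<open>Splitting off the last summand gives a convolution recursion, which drives every count
  below.\<close>

lemma card_sum_solutions_Suc:
  assumes "\<And>k. finite (S k)"
  shows "card (sum_solutions (Suc n) S w) = (\<Sum>v\<in>S (Suc n). card (sum_solutions n S (w - v)))"
proof -
  have "bij_betw (\<lambda>(v, V). V(Suc n := v)) (SIGMA v:S (Suc n). sum_solutions n S (w - v))
      (sum_solutions (Suc n) S w)"
  \<comment> \<open>Position \<open>Suc n\<close> is reset to \<open>undefined\<close> because the
    shorter sequence must be extensional on \<open>{1..n}\<close>.\<close>
  proof (rule bij_betw_byWitness[where f' = "\<lambda>V. (V (Suc n), V(Suc n := undefined))"])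
    show "\<forall>a\<in>SIGMA v:S (Suc n). sum_solutions n S (w - v).
        (\<lambda>V. (V (Suc n), V(Suc n := undefined))) ((\<lambda>(v, V). V(Suc n := v)) a) = a"
      by (auto simp: sum_solutions_def fun_eq_iff PiE_def extensional_def)
    show "\<forall>a'\<in>sum_solutions (Suc n) S w. (\<lambda>(v, V). V(Suc n := v)) (a' (Suc n), a'(Suc n := undefined)) = a'"
      by auto
    show "(\<lambda>(v, V). V(Suc n := v)) ` (SIGMA v:S (Suc n). sum_solutions n S (w - v)) \<subseteq> sum_solutions (Suc n) S w"
      by (auto simp: sum_solutions_def PiE_def extensional_def Pi_def)
    show "(\<lambda>V. (V (Suc n), V(Suc n := undefined))) ` sum_solutions (Suc n) S w
        \<subseteq> (SIGMA v:S (Suc n). sum_solutions n S (w - v))"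
      by (auto simp: sum_solutions_def PiE_def extensional_def Pi_def)
  qed
  then have "card (sum_solutions (Suc n) S w) = card (SIGMA v:S (Suc n). sum_solutions n S (w - v))"
    by (simp add: bij_betw_same_card)
  also have "\<dots> = (\<Sum>v\<in>S (Suc n). card (sum_solutions n S (w - v)))"
    using assms by (simp add: finite_sum_solutions)
  finally show ?thesis .
qed

lemma finite_bal [simp]: "finite bal" and finite_partners [simp]: "finite (partners u)"
  by (auto simp: bal_def partners_def)

lemma partners_eq:
  "partners (0,0,1,1) = {(0,1,0,1), (1,0,1,0), (0,1,1,0), (1,0,0,1)}"
  "partners (1,1,0,0) = {(0,1,0,1), (1,0,1,0), (0,1,1,0), (1,0,0,1)}"
  "partners (0,1,0,1) = {(0,0,1,1), (1,1,0,0), (0,1,1,0), (1,0,0,1)}"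
  "partners (1,0,1,0) = {(0,0,1,1), (1,1,0,0), (0,1,1,0), (1,0,0,1)}"
  "partners (0,1,1,0) = {(0,0,1,1), (1,1,0,0), (0,1,0,1), (1,0,1,0)}"
  "partners (1,0,0,1) = {(0,0,1,1), (1,1,0,0), (0,1,0,1), (1,0,1,0)}"
  by (auto simp: partners_def bal_def ones_def)

lemma bal_cases:
  assumes "u \<in> bal"
  obtains "u = (0,0,1,1)" | "u = (1,1,0,0)" | "u = (0,1,0,1)" | "u = (1,0,1,0)" | "u = (0,1,1,0)" | "u = (1,0,0,1)"
  using assms by (auto simp: bal_def)


lemma sum_partners:
  fixes f :: "col \<Rightarrow> nat"
  shows
  "sum f (partners (0,0,1,1)) = f (0,1,0,1) + f (1,0,1,0) + f (0,1,1,0) + f (1,0,0,1)"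
  "sum f (partners (1,1,0,0)) = f (0,1,0,1) + f (1,0,1,0) + f (0,1,1,0) + f (1,0,0,1)"
  "sum f (partners (0,1,0,1)) = f (0,0,1,1) + f (1,1,0,0) + f (0,1,1,0) + f (1,0,0,1)"
  "sum f (partners (1,0,1,0)) = f (0,0,1,1) + f (1,1,0,0) + f (0,1,1,0) + f (1,0,0,1)"
  "sum f (partners (0,1,1,0)) = f (0,0,1,1) + f (1,1,0,0) + f (0,1,0,1) + f (1,0,1,0)"
  "sum f (partners (1,0,0,1)) = f (0,0,1,1) + f (1,1,0,0) + f (0,1,0,1) + f (1,0,1,0)"
  by (simp_all add: partners_eq add.assoc)

lemma sum_bal:
  fixes f :: "col \<Rightarrow> int"
  shows "sum f bal = f (0,0,1,1) + f (1,1,0,0) + f (0,1,0,1) + f (1,0,1,0) + f (0,1,1,0) + f (1,0,0,1)"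
  by (simp add: bal_def add.assoc)

text \<open>With \<open>all_bit\<close>, this turns quantifiers over columns into finite
  conjunctions, so that finite facts about columns are settled by evaluation.\<close>

lemma all_col: "(\<forall>w::col. P w) \<longleftrightarrow> (\<forall>a b c d. P (a, b, c, d))"
  by (metis prod.collapse)

lemma all_bit: "(\<forall>a::bit. P a) \<longleftrightarrow> P 0 \<and> P 1"
  by (metis bit.exhaust)

lemma dot_diff_right: "dot t (w - v) = dot t w + dot t v"
  by (cases t; cases w; cases v) (simp add: algebra_simps)

lemma dot_add_left: "dot (t + u) v = dot t v + dot u v"
  by (cases t; cases u; cases v) (simp add: algebra_simps)

text \<open>Among the eight even columns, \<open>dot t\<close> vanishes exactly at \<open>0\<close>,
  \<open>ones\<close>, \<open>t\<close> and \<open>t + ones\<close>; the other four are the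
  partners. Being a partner thus becomes an affine condition over the field of two elements.\<close>

lemma partners_eq_dot:
  assumes "t \<in> bal"
  shows "partners t = {v \<in> even_cols. dot t v = 1}"
proof -
  have "\<forall>v. \<forall>t\<in>bal. v \<in> partners t \<longleftrightarrow> dot ones v = 0 \<and> dot t v = 1"
    unfolding all_col all_bit bal_def ball_simps partners_eq ones_def by simp
  then show ?thesis using assms by (auto simp: even_cols_def)
qed

lemma partners_add_ones: "partners (t + ones) = partners t"
  by (cases t) (auto simp: partners_def ones_def add.assoc)

text \<open>Subtracting a partner, a column of even weight, does not affect membership in
  \<open>even_cols\<close>, so all four terms are equal.\<close>

lemma sum_even_cols:
  assumes "u \<in> bal"
  shows "(\<Sum>v\<in>partners u. of_bool (w - v \<in> even_cols)) = (4::nat) * of_bool (w \<in> even_cols)"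
proof -
  have "card (partners u) = 4"
    using assms by (elim bal_cases) (simp_all add: partners_eq)
  moreover have "(\<Sum>v\<in>partners u. of_bool (w - v \<in> even_cols)) = (\<Sum>v\<in>partners u. of_bool (w \<in> even_cols) :: nat)"
    by (rule sum.cong) (auto simp: partners_eq_dot[OF assms] even_cols_def dot_diff_right)
  ultimately show ?thesis by simp
qed

text \<open>All four partners of \<open>u\<close> have \<open>dot t v = 1\<close>, so each of them
  moves the coset for \<open>n\<close> to the coset for \<open>Suc n\<close>.\<close>

lemma sum_coset_same_type:
  assumes "t \<in> bal" "u \<in> {t, t + ones}"
  shows "(\<Sum>v\<in>partners u. of_bool (w - v \<in> type_coset t n)) = (4::nat) * of_bool (w \<in> type_coset t (Suc n))"
proof -
  have u: "u \<in> bal"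
    using assms by (elim bal_cases) (auto simp: ones_def bal_def)
  have "dot t v = 1" if "v \<in> partners u" for v
    using assms(2) that by (auto simp: partners_eq_dot[OF u] even_cols_def dot_add_left)
  then have "w - v \<in> type_coset t n \<longleftrightarrow> w \<in> type_coset t (Suc n)" if "v \<in> partners u" for v
    using that
    by (cases "dot t w"; cases "of_nat n :: bit")
       (auto simp: partners_eq_dot[OF u] even_cols_def type_coset_def dot_diff_right)
  then have "(\<Sum>v\<in>partners u. of_bool (w - v \<in> type_coset t n)) = (\<Sum>v\<in>partners u. of_bool (w \<in> type_coset t (Suc n)) :: nat)"
    by (intro sum.cong) auto
  moreover have "card (partners u) = 4"
    using u by (elim bal_cases) (simp_all add: partners_eq)
  ultimately show ?thesis by simp
qed

text \<open>Of the four partners of \<open>u\<close>, two have \<open>dot t v = 0\<close> and two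
  have \<open>dot t v = 1\<close>. Whatever the parity of \<open>n\<close>, half of them hit the
  coset, and the equation on \<open>dot t\<close> disappears.\<close>

lemma sum_coset_other_type:
  assumes "t \<in> bal" "u \<in> bal" "u \<notin> {t, t + ones}"
  shows "(\<Sum>v\<in>partners u. of_bool (w - v \<in> type_coset t n)) = (2::nat) * of_bool (w \<in> even_cols)"
proof -
  have "\<forall>t\<in>bal. \<forall>u\<in>bal. u \<notin> {t, t + ones} \<longrightarrow> (\<forall>e. (\<Sum>v\<in>partners u. of_bool (dot t v = e)) = (2::nat))"
    unfolding all_bit bal_def ball_simps sum_partners ones_def by simp
  then have two: "(\<Sum>v\<in>partners u. of_bool (dot t v = e)) = (2::nat)" for e
    using assms by blast
  have "w - v \<in> type_coset t n \<longleftrightarrow> w \<in> even_cols \<and> dot t v = dot t w + of_nat n" if "v \<in> partners u" for v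
    using that
    by (cases "dot t w"; cases "of_nat n :: bit"; cases "dot t v")
       (auto simp: partners_eq_dot[OF assms(2)] even_cols_def type_coset_def dot_diff_right)
  then have "(\<Sum>v\<in>partners u. of_bool (w - v \<in> type_coset t n))
      = (\<Sum>v\<in>partners u. of_bool (w \<in> even_cols) * of_bool (dot t v = dot t w + of_nat n) :: nat)"
    by (intro sum.cong) auto
  also have "\<dots> = of_bool (w \<in> even_cols) * (\<Sum>v\<in>partners u. of_bool (dot t v = dot t w + of_nat n) :: nat)"
    by (simp add: sum_distrib_left)
  finally show ?thesis unfolding two by simp
qed
text \<open>The \<open>4 ^ n\<close> choices of partners have sums spread uniformly over the four
  elements of \<open>type_coset t n\<close>.\<close>

lemma card_partner_solutions_const:
  assumes "t \<in> bal" "\<And>k. k \<in> {1..n} \<Longrightarrow> U k \<in> {t, t + ones}" "n \<ge> 1"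
  shows "4 * card (sum_solutions n (\<lambda>k. partners (U k)) w) = 4 ^ n * of_bool (w \<in> type_coset t n)"
  using assms(3,2)
\<comment> \<open>The induction starts at 1, since the empty sum takes only the value 0 and is not
  uniform on a coset.\<close>
proof (induction n arbitrary: w rule: dec_induct)
  case base
  have "card (sum_solutions 1 (\<lambda>k. partners (U k)) w) = (\<Sum>v\<in>partners (U 1). of_bool (w - v = 0))"
    by (simp add: card_sum_solutions_Suc[where n = 0, simplified] card_sum_solutions_0)
  also have "\<dots> = of_bool (w \<in> partners (U 1))"
    by (simp add: of_bool_def sum.delta')
  also have "partners (U 1) = type_coset t 1"
    using base[of 1] assms(1) by (auto simp: type_coset_def partners_add_ones partners_eq_dot)
  finally show ?case by simp
next
  case (step n)
  have "4 * card (sum_solutions (Suc n) (\<lambda>k. partners (U k)) w)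
      = (\<Sum>v\<in>partners (U (Suc n)). 4 * card (sum_solutions n (\<lambda>k. partners (U k)) (w - v)))"
    by (simp add: card_sum_solutions_Suc sum_distrib_left)
  also have "\<dots> = (\<Sum>v\<in>partners (U (Suc n)). 4 ^ n * of_bool (w - v \<in> type_coset t n))"
    using step by (intro sum.cong) auto
  also have "\<dots> = 4 ^ n * (\<Sum>v\<in>partners (U (Suc n)). of_bool (w - v \<in> type_coset t n))"
    by (simp add: sum_distrib_left)
  also have "\<dots> = 4 ^ Suc n * of_bool (w \<in> type_coset t (Suc n))"
    by (subst sum_coset_same_type) (use assms(1) step in auto)
  finally show ?case .
qed

text \<open>The exceptional configuration: \<open>t\<close> and \<open>t + ones\<close> have the
  same partners, so the low bits keep the extra equation of \<open>type_coset\<close>.\<close>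

definition const_type :: "nat \<Rightarrow> (nat \<Rightarrow> col) \<Rightarrow> col \<Rightarrow> bool" where
  "const_type n U t \<longleftrightarrow> (\<forall>k\<in>{1..n}. U k \<in> {t, t + ones})"

text \<open>The first column of a second type makes the sums uniform on the eight even columns, and
  further columns preserve uniformity.\<close>

lemma card_partner_solutions_nonconst:
  assumes "\<And>k. k \<in> {1..n} \<Longrightarrow> U k \<in> bal" "\<And>t. t \<in> bal \<Longrightarrow> \<not> const_type n U t"
  shows "8 * card (sum_solutions n (\<lambda>k. partners (U k)) w) = 4 ^ n * of_bool (w \<in> even_cols)"
  using assms
proof (induction n arbitrary: w)
  \<comment> \<open>The empty sequence is constant of every type, so the second hypothesis
    fails.\<close>
  case 0
  then show ?case by (auto simp: const_type_def bal_def)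
next
  case (Suc n)
  let ?c = "\<lambda>w. card (sum_solutions n (\<lambda>k. partners (U k)) w)"
  have U: "U (Suc n) \<in> bal" using Suc.prems(1) by auto
  have eq: "8 * card (sum_solutions (Suc n) (\<lambda>k. partners (U k)) w)
      = (\<Sum>v\<in>partners (U (Suc n)). 8 * ?c (w - v))"
    by (simp add: card_sum_solutions_Suc sum_distrib_left)
  show ?case
  proof (cases "\<exists>t\<in>bal. const_type n U t")
    case True
    then obtain t where t: "t \<in> bal" "const_type n U t" by blast
    have "n \<ge> 1"
    proof (rule ccontr)
      assume "\<not> n \<ge> 1"
      then have "n = 0" by simp
      then have "const_type (Suc n) U (U (Suc n))" by (auto simp: const_type_def)
      then show False using Suc.prems(2) U by blast
    qed
    then have c: "8 * ?c v = 2 * 4 ^ n * of_bool (v \<in> type_coset t n)" for v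
      using card_partner_solutions_const[of t n U v] t by (auto simp: const_type_def)
    \<comment> \<open>The last column is the first one to leave the type \<open>t\<close>.\<close>
    have ne: "U (Suc n) \<notin> {t, t + ones}"
    proof
      assume "U (Suc n) \<in> {t, t + ones}"
      then have "const_type (Suc n) U t"
        using t(2) by (auto simp: const_type_def le_Suc_eq)
      then show False using Suc.prems(2) t(1) by blast
    qed
    show ?thesis
      unfolding eq c sum_distrib_left[symmetric] sum_coset_other_type[OF t(1) U ne] by simp
  next
    case False
    then have c: "8 * ?c v = 4 ^ n * of_bool (v \<in> even_cols)" for v
      using Suc by auto
    show ?thesis
      unfolding eq c sum_distrib_left[symmetric] sum_even_cols[OF U] by simp
  qed
qed

text \<open>The count depends only on the class of \<open>s\<close>: \<open>{0, ones}\<close>,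
  \<open>bal\<close>, or odd weight. With values \<open>x\<close> and \<open>y\<close> on the first
  two classes, one more column gives \<open>6 * y\<close> and \<open>2 * x + 4 * y\<close>, a
  recursion with eigenvalues 6 and -2.\<close>

lemma card_bal_solutions:
  assumes "n \<ge> 1"
  shows "8 * int (card (sum_solutions n (\<lambda>_. bal) s)) =
    (if s \<in> {0, ones} then 6 ^ n + 3 * (- 2) ^ n else if s \<in> bal then 6 ^ n - (- 2) ^ n else 0)"
  using assms
proof (induction n arbitrary: s rule: dec_induct)
  case base
  have "card (sum_solutions 1 (\<lambda>_. bal) s) = (\<Sum>v\<in>bal. of_bool (s - v = 0))"
    by (simp add: card_sum_solutions_Suc[where n = 0, simplified] card_sum_solutions_0)
  also have "\<dots> = of_bool (s \<in> bal)"
    by (simp add: of_bool_def sum.delta')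
  finally have "card (sum_solutions 1 (\<lambda>_. bal) s) = of_bool (s \<in> bal)" .
  moreover have "s \<notin> bal" if "s \<in> {0, ones}"
    using that by (elim insertE) (simp_all add: bal_def ones_def zero_prod_def)
  ultimately show ?case by simp
next
  case (step n)
  have "8 * int (card (sum_solutions (Suc n) (\<lambda>_. bal) s))
      = (\<Sum>v\<in>bal. 8 * int (card (sum_solutions n (\<lambda>_. bal) (s - v))))"
    by (simp add: card_sum_solutions_Suc sum_distrib_left)
  also have "\<dots> = (\<Sum>v\<in>bal. if s - v \<in> {0, ones} then 6 ^ n + 3 * (- 2) ^ n
      else if s - v \<in> bal then 6 ^ n - (- 2) ^ n else 0)"
    by (simp only: step.IH)
  also have "\<dots> = (if s \<in> {0, ones} then 6 ^ Suc n + 3 * (- 2) ^ Suc n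
      else if s \<in> bal then 6 ^ Suc n - (- 2) ^ Suc n else 0)"
  proof -
    \<comment> \<open>From \<open>0\<close> or \<open>ones\<close>, all six differences are
      balanced. From a balanced \<open>s\<close>, the choices \<open>v = s\<close> and
      \<open>v = s + ones\<close> lead to \<open>{0, ones}\<close> and the other four to
      \<open>bal\<close>.\<close>
    have "\<forall>s. (\<Sum>v\<in>bal. if s - v \<in> {0, ones} then x else if s - v \<in> bal then y else 0)
        = (if s \<in> {0, ones} then 6 * y else if s \<in> bal then 2 * x + 4 * y else 0)" for x y :: int
      unfolding all_col all_bit sum_bal unfolding bal_def ones_def zero_prod_def
      by (simp add: zero_prod_def)
    from this[of "6 ^ n + 3 * (- 2) ^ n" "6 ^ n - (- 2) ^ n", THEN spec, of s] show ?thesis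
      by (simp split del: if_split cong: if_cong)
  qed
  finally show ?case .
qed

text \<open>Each further column swaps the classes \<open>{0, ones}\<close> and
  \<open>{(0,0,1,1), (1,1,0,0)}\<close>, and the sums stay uniform on the current class.\<close>

lemma card_const_solutions:
  assumes "n \<ge> 1"
  shows "2 * card (sum_solutions n (\<lambda>_. {(0,0,1,1), (1,1,0,0)}) s) =
    2 ^ n * of_bool (s \<in> (if odd n then {(0,0,1,1), (1,1,0,0)} else {0, ones}))"
  using assms
proof (induction n arbitrary: s rule: dec_induct)
  case base
  show ?case
    by (simp add: card_sum_solutions_Suc[where n = 0, simplified] card_sum_solutions_0)
next
  case (step n)
  have "2 * card (sum_solutions (Suc n) (\<lambda>_. {(0,0,1,1), (1,1,0,0)}) s)
      = (\<Sum>v\<in>{(0,0,1,1), (1,1,0,0)}. 2 * card (sum_solutions n (\<lambda>_. {(0,0,1,1), (1,1,0,0)}) (s - v)))"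
    by (simp add: card_sum_solutions_Suc sum_distrib_left)
  also have "\<dots> = (\<Sum>v\<in>{(0,0,1,1), (1,1,0,0)}.
      2 ^ n * of_bool (s - v \<in> (if odd n then {(0,0,1,1), (1,1,0,0)} else {0, ones})))"
    by (simp only: step.IH)
  also have "\<dots> = 2 ^ Suc n * of_bool (s \<in> (if odd (Suc n) then {(0,0,1,1), (1,1,0,0)} else {0, ones}))"
  proof -
    let ?C = "{(0,0,1,1), (1,1,0,0)} :: col set" and ?D = "{0, ones}"
    have "\<forall>s. of_bool (s - (0,0,1,1) \<in> ?C) + of_bool (s - (1,1,0,0) \<in> ?C) = (2::nat) * of_bool (s \<in> ?D)"
      and "\<forall>s. of_bool (s - (0,0,1,1) \<in> ?D) + of_bool (s - (1,1,0,0) \<in> ?D) = (2::nat) * of_bool (s \<in> ?C)"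
      unfolding all_col all_bit ones_def zero_prod_def by (simp_all add: zero_prod_def)
    note * = this[THEN spec, of s]
    have "(\<Sum>v\<in>?C. 2 ^ n * of_bool (s - v \<in> E)) =
        (2::nat) ^ n * (of_bool (s - (0,0,1,1) \<in> E) + of_bool (s - (1,1,0,0) \<in> E))" for E
      by (subst sum.insert) (simp_all add: distrib_left)
    note sum_eq = this
    show ?thesis
      unfolding sum_eq
      by (cases "odd n") (simp_all only: * even_Suc if_True if_False simp_thms power_Suc mult_ac)
  qed
  finally show ?case .
qed


subsection \<open>Transversals as pairs of column sequences\<close>

definition hi :: "nat \<Rightarrow> bit" where
  "hi x = of_nat (l_half x)"

definition lo :: "nat \<Rightarrow> bit" where
  "lo x = of_nat x"

definition mk :: "bit \<Rightarrow> bit \<Rightarrow> nat" where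
  "mk a b = (if a = 1 then 2 else 0) + (if b = 1 then 1 else 0)"

lemma hi_mk [simp]: "hi (mk a b) = a" and lo_mk [simp]: "lo (mk a b) = b"
  by (cases a; cases b; simp add: hi_def lo_def mk_def l_half_def)+

lemma mk_in_Sigma4 [simp]: "mk a b \<in> Sigma4"
  by (cases a; cases b) (auto simp: mk_def Sigma4_def)

lemma mk_hi_lo [simp]: "x \<in> Sigma4 \<Longrightarrow> mk (hi x) (lo x) = x"
  by (auto simp: Sigma4_def hi_def lo_def mk_def l_half_def)

lemma mk_eq_iff [simp]: "mk a b = mk c d \<longleftrightarrow> a = c \<and> b = d"
  by (cases a; cases b; cases c; cases d) (simp_all add: mk_def)

lemma of_nat_bit_eq_0_iff: "(of_nat m :: bit) = 0 \<longleftrightarrow> even m"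
  using even_of_nat[where 'a = bit, of m] by (cases "of_nat m :: bit") auto

text \<open>Passing from \<open>m\<close> to \<open>Suc m\<close> raises the half exactly when
  \<open>m\<close> is odd.\<close>

lemma of_nat_half_Suc: "(of_nat (Suc m div 2) :: bit) = of_nat (m div 2) + of_nat m"
  by (cases "even m") (auto elim!: evenE oddE)

lemma bit_add_eq_0_iff: "a + b = 0 \<longleftrightarrow> a = b" for a b :: bit
  by (cases a; cases b) auto

text \<open>
  The Boolean function \<open>\<lambda>\<close> of the definition is passed as a function \<open>L\<close> of the support of its argument.
\<close>

definition semi_form :: "nat \<Rightarrow> (nat set \<Rightarrow> bit) \<Rightarrow> ((nat \<Rightarrow> nat) \<Rightarrow> nat) \<Rightarrow> bool" where
  "semi_form n L f \<longleftrightarrow> quasigroup4 n f \<and>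
     (\<forall>x\<in>vecs {0..n}. op_graph n f x \<longleftrightarrow>
        (\<Sum>i=0..n. hi (x i)) = 0 \<and> (\<Sum>i=0..n. lo (x i)) = L {i \<in> {1..n}. hi (x i) = 1})"

lemma hi_eq_1_iff: "hi x = 1 \<longleftrightarrow> l_half x = 1"
  by (auto simp: hi_def l_half_def)

lemma standardly_semilinear_iff: "standardly_semilinear n f \<longleftrightarrow> (\<exists>L. semi_form n L f)"
proof
  assume "standardly_semilinear n f"
  then obtain bf where q: "quasigroup4 n f" and bf: "bf \<in> ({1..n} \<rightarrow>\<^sub>E {0, 1}) \<rightarrow> {0, 1 :: nat}"
    and g: "\<And>x. x \<in> vecs {0..n} \<Longrightarrow> op_graph n f x \<longleftrightarrow> even (\<Sum>i=0..n. l_half (x i)) \<and>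
          even ((\<Sum>i=0..n. x i) + bf (\<lambda>i\<in>{1..n}. l_half (x i)))"
    unfolding standardly_semilinear_def by blast
  \<comment> \<open>A vector of high bits and its support determine each other; the Boolean function
    is evaluated at the indicator vector of \<open>S\<close>.\<close>
  define L where "L S = (of_nat (bf (\<lambda>i\<in>{1..n}. of_bool (i \<in> S))) :: bit)" for S
  have "(\<lambda>i\<in>{1..n}. of_bool (i \<in> {i \<in> {1..n}. hi (x i) = 1})) = (\<lambda>i\<in>{1..n}. l_half (x i))" for x
    by (rule restrict_ext) (auto simp: hi_def l_half_def)
  then have L: "L {i \<in> {1..n}. hi (x i) = 1} = of_nat (bf (\<lambda>i\<in>{1..n}. l_half (x i)))" for x
    unfolding L_def by simp
  have "semi_form n L f"
    unfolding semi_form_def L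
    by (simp add: q g of_nat_bit_eq_0_iff[symmetric] hi_def lo_def bit_add_eq_0_iff)
  then show "\<exists>L. semi_form n L f" by blast
next
  assume "\<exists>L. semi_form n L f"
  then obtain L where q: "quasigroup4 n f" and
    g: "\<And>x. x \<in> vecs {0..n} \<Longrightarrow> op_graph n f x \<longleftrightarrow>
        (\<Sum>i=0..n. hi (x i)) = 0 \<and> (\<Sum>i=0..n. lo (x i)) = L {i \<in> {1..n}. hi (x i) = 1}"
    unfolding semi_form_def by blast
  define bf where "bf u = (of_bool (L {i \<in> {1..n}. u i = 1} = 1) :: nat)" for u :: "nat \<Rightarrow> nat"
  have "{i \<in> {1..n}. (\<lambda>i\<in>{1..n}. l_half (x i)) i = 1} = {i \<in> {1..n}. hi (x i) = 1}" for x
    by (auto simp: hi_eq_1_iff)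
  then have bf: "(of_nat (bf (\<lambda>i\<in>{1..n}. l_half (x i))) :: bit) = L {i \<in> {1..n}. hi (x i) = 1}" for x
    unfolding bf_def by (cases "L {i \<in> {1..n}. hi (x i) = 1}") simp_all
  have "op_graph n f x \<longleftrightarrow> even (\<Sum>i=0..n. l_half (x i)) \<and>
          even ((\<Sum>i=0..n. x i) + bf (\<lambda>i\<in>{1..n}. l_half (x i)))" if "x \<in> vecs {0..n}" for x
    using g[OF that] unfolding of_nat_bit_eq_0_iff[symmetric] of_nat_add bf of_nat_sum
    by (simp add: hi_def lo_def bit_add_eq_0_iff)
  moreover have "bf \<in> ({1..n} \<rightarrow>\<^sub>E {0, 1}) \<rightarrow> {0, 1}"
    by (auto simp: bf_def)
  ultimately show "standardly_semilinear n f"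
    unfolding standardly_semilinear_def using q by blast
qed

text \<open>
  Ordering the rows by their \<open>0\<close>-th coordinate represents every transversal exactly once.
\<close>

definition ordered_transversals :: "nat \<Rightarrow> ((nat \<Rightarrow> nat) \<Rightarrow> nat) \<Rightarrow> (nat \<Rightarrow> nat \<Rightarrow> nat) set" where
  "ordered_transversals n f = {R \<in> Sigma4 \<rightarrow>\<^sub>E vecs {0..n}.
     (\<forall>i\<in>Sigma4. R i 0 = i \<and> op_graph n f (R i)) \<and> (\<forall>k\<in>{1..n}. inj_on (\<lambda>i. R i k) Sigma4)}"

lemma card_Sigma4: "card Sigma4 = 4" and finite_Sigma4 [simp]: "finite Sigma4"
  by (auto simp: Sigma4_def)

lemma num_transversals_eq_card_ordered: "num_transversals n f = card (ordered_transversals n f)"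
proof -
  have "bij_betw (\<lambda>R. R ` Sigma4) (ordered_transversals n f) {T. transversal n f T}"
    unfolding bij_betw_def
  proof
    show "inj_on (\<lambda>R. R ` Sigma4) (ordered_transversals n f)"
    proof (rule inj_onI)
      fix R R' assume R: "R \<in> ordered_transversals n f" "R' \<in> ordered_transversals n f"
        and eq: "R ` Sigma4 = R' ` Sigma4"
      have "R i = R' i" if "i \<in> Sigma4" for i
      proof -
        obtain j where j: "j \<in> Sigma4" "R i = R' j" using eq \<open>i \<in> Sigma4\<close> by blast
        have "i = R i 0" "R' j 0 = j"
          using R that j(1) by (auto simp: ordered_transversals_def)
        then show ?thesis using j by simp
      qed
      then show "R = R'"
        using R by (auto simp: ordered_transversals_def intro!: PiE_ext[of R Sigma4 "\<lambda>_. vecs {0..n}" R'])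
    qed
    show "(\<lambda>R. R ` Sigma4) ` ordered_transversals n f = {T. transversal n f T}"
    proof (intro equalityI subsetI)
      fix T assume "T \<in> (\<lambda>R. R ` Sigma4) ` ordered_transversals n f"
      then obtain R where R: "R \<in> Sigma4 \<rightarrow>\<^sub>E vecs {0..n}" "\<And>i. i \<in> Sigma4 \<Longrightarrow> R i 0 = i"
        "\<And>i. i \<in> Sigma4 \<Longrightarrow> op_graph n f (R i)"
        "\<And>k. k \<in> {1..n} \<Longrightarrow> inj_on (\<lambda>i. R i k) Sigma4" and T: "T = R ` Sigma4"
        unfolding ordered_transversals_def by auto
      have inj: "inj_on (\<lambda>i. R i k) Sigma4" if "k \<in> {0..n}" for k
        using R(2) R(4)[of k] that by (cases "k = 0") (auto simp: inj_on_def)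
      have "inj_on R Sigma4" using R(2) by (metis inj_onI)
      then have "card T = 4" by (simp add: T card_image card_Sigma4)
      then show "T \<in> {T. transversal n f T}"
        unfolding T transversal_def mem_Collect_eq
      proof (intro conjI ballI impI)
        show "R ` Sigma4 \<subseteq> vecs {0..n}" using R(1) by (auto dest: PiE_mem)
        fix a b k assume "a \<in> R ` Sigma4" "b \<in> R ` Sigma4" "a \<noteq> b" "k \<in> {0..n}"
        then obtain i j where "i \<in> Sigma4" "j \<in> Sigma4" "a = R i" "b = R j" "i \<noteq> j" by blast
        then show "a k \<noteq> b k" using inj_onD[OF inj[OF \<open>k \<in> {0..n}\<close>], of i j] by blast
      next
        show "card (R ` Sigma4) = 4" using \<open>card T = 4\<close> T by simp
        fix a assume "a \<in> R ` Sigma4"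
        then show "op_graph n f a" using R(3) by blast
      qed
    next
      fix T assume "T \<in> {T. transversal n f T}"
      then have sub: "T \<subseteq> vecs {0..n}" and cT: "card T = 4" and gr: "\<And>a. a \<in> T \<Longrightarrow> op_graph n f a"
        and dis: "\<And>a b k. a \<in> T \<Longrightarrow> b \<in> T \<Longrightarrow> a \<noteq> b \<Longrightarrow> k \<in> {0..n} \<Longrightarrow> a k \<noteq> b k"
        unfolding transversal_def by auto
      \<comment> \<open>Four distinct values in a set of four elements: every value occurs exactly
        once as a 0-th coordinate and names its row.\<close>
      have inj: "inj_on (\<lambda>a. a 0) T" using dis by (auto simp: inj_on_def)
      have "(\<lambda>a. a 0) ` T \<subseteq> Sigma4" using sub by (auto simp: PiE_def Pi_def)
      then have surj: "(\<lambda>a. a 0) ` T = Sigma4"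
        by (intro card_subset_eq) (simp_all add: card_image[OF inj] cT card_Sigma4)
      define R where "R = (\<lambda>i\<in>Sigma4. inv_into T (\<lambda>a. a 0) i)"
      have R: "R i \<in> T" "R i 0 = i" if "i \<in> Sigma4" for i
        using that surj inv_into_into[of i "\<lambda>a. a 0" T] f_inv_into_f[of i "\<lambda>a. a 0" T]
        by (auto simp: R_def)
      have "R \<in> ordered_transversals n f"
        unfolding ordered_transversals_def
      proof (intro CollectI conjI ballI)
        show "R \<in> Sigma4 \<rightarrow>\<^sub>E vecs {0..n}"
          using R(1) sub by (auto simp: R_def)
        fix k assume k: "k \<in> {1..n}"
        show "inj_on (\<lambda>i. R i k) Sigma4"
        proof (rule inj_onI)
          fix i j assume ij: "i \<in> Sigma4" "j \<in> Sigma4" "R i k = R j k"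
          then have "R i = R j" using dis[of "R i" "R j" k] R(1) k by auto
          then show "i = j" using R(2) ij by metis
        qed
      qed (use R gr in auto)
      moreover have "R ` Sigma4 = T"
      proof (rule card_subset_eq)
        show "finite T" using cT by (simp add: card_ge_0_finite)
        show "R ` Sigma4 \<subseteq> T" using R(1) by blast
        have "inj_on R Sigma4" using R(2) by (metis inj_onI)
        then show "card (R ` Sigma4) = card T" by (simp add: card_image card_Sigma4 cT)
      qed
      ultimately show "T \<in> (\<lambda>R. R ` Sigma4) ` ordered_transversals n f" by blast
    qed
  qed
  then show ?thesis
    unfolding num_transversals_def by (simp add: bij_betw_same_card)
qed

section \<open>Bits of the rows, arranged by columns\<close>

definition pr :: "nat \<Rightarrow> col \<Rightarrow> bit" where
  "pr i w = (case w of (a, b, c, d) \<Rightarrow> [a, b, c, d] ! i)"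

definition row_set :: "nat \<Rightarrow> (nat \<Rightarrow> col) \<Rightarrow> nat \<Rightarrow> nat set" where
  "row_set n U i = {k \<in> {1..n}. pr i (U k) = 1}"

text \<open>The values of \<open>L\<close> on the four rows are collected into a column, so that the
  low-bit conditions of all rows form one equation.\<close>

definition row_vals :: "nat \<Rightarrow> (nat set \<Rightarrow> bit) \<Rightarrow> (nat \<Rightarrow> col) \<Rightarrow> col" where
  "row_vals n L U = (L (row_set n U 0), L (row_set n U 1), L (row_set n U 2), L (row_set n U 3))"

text \<open>The 0-th column \<open>0, 1, 2, 3\<close> has high bits \<open>(0,0,1,1)\<close>, so the
  high bits of the other columns must add up to the same.\<close>

abbreviation upper_cols :: "nat \<Rightarrow> (nat \<Rightarrow> col) set" where
  "upper_cols n \<equiv> sum_solutions n (\<lambda>_. bal) (0,0,1,1)"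

lemma ball_Sigma4: "(\<forall>i\<in>Sigma4. P i) \<longleftrightarrow> P 0 \<and> P 1 \<and> P 2 \<and> P 3"
  by (simp add: Sigma4_def)

lemma pr_simps [simp]:
  "pr 0 (a, b, c, d) = a" "pr (Suc 0) (a, b, c, d) = b" "pr 2 (a, b, c, d) = c" "pr 3 (a, b, c, d) = d"
  by (simp_all add: pr_def numeral_eq_Suc)

lemma col_eq_iff: "w = w' \<longleftrightarrow> (\<forall>i\<in>Sigma4. pr i w = pr i w')"
  by (cases w; cases w') (simp add: ball_Sigma4)

lemma pr_add: "i \<in> Sigma4 \<Longrightarrow> pr i (w + w') = pr i w + pr i w'"
  by (cases w; cases w') (auto simp: Sigma4_def)

lemma pr_sum: "i \<in> Sigma4 \<Longrightarrow> pr i (sum U A) = (\<Sum>k\<in>A. pr i (U k))"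
proof (induction A rule: infinite_finite_induct)
  case (infinite A)
  then show ?case by (auto simp: Sigma4_def zero_prod_def)
next
  case empty
  then show ?case by (auto simp: Sigma4_def zero_prod_def)
qed (simp add: pr_add)

lemma pr_hi: "i \<in> Sigma4 \<Longrightarrow> pr i (0,0,1,1) = hi i"
  and pr_lo: "i \<in> Sigma4 \<Longrightarrow> pr i (0,1,0,1) = lo i"
  by (auto simp: Sigma4_def hi_def lo_def l_half_def)

lemma pr_row_vals: "i \<in> Sigma4 \<Longrightarrow> pr i (row_vals n L U) = L (row_set n U i)"
  by (auto simp: Sigma4_def row_vals_def)

text \<open>Four distinct pairs of bits exhaust all pairs; hence both bit columns are balanced and
  neither equal nor complementary.\<close>

lemma partner_iff_distinct:
  "u \<in> bal \<and> v \<in> partners u \<longleftrightarrow> inj_on (\<lambda>i. mk (pr i u) (pr i v)) Sigma4"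
proof -
  obtain a b c d where u: "u = (a, b, c, d)" by (cases u) auto
  obtain p q r s where v: "v = (p, q, r, s)" by (cases v) auto
  have "(a, b, c, d) \<in> bal \<and> (p, q, r, s) \<in> partners (a, b, c, d) \<longleftrightarrow>
      distinct [(a, p), (b, q), (c, r), (d, s)]"
    unfolding partners_def bal_def ones_def
    by (cases a; cases b; cases c; cases d; cases p; cases q; cases r; cases s; simp)
  also have "\<dots> \<longleftrightarrow> inj_on (\<lambda>i. mk (pr i u) (pr i v)) Sigma4"
    unfolding inj_on_def ball_Sigma4 u v by auto
  finally show ?thesis unfolding u v .
qed


definition build_row :: "nat \<Rightarrow> (nat \<Rightarrow> col) \<Rightarrow> (nat \<Rightarrow> col) \<Rightarrow> nat \<Rightarrow> nat \<Rightarrow> nat" where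
  "build_row n U V i = (\<lambda>k\<in>{0..n}. if k = 0 then i else mk (pr i (U k)) (pr i (V k)))"

definition row_bits :: "(nat \<Rightarrow> bit) \<Rightarrow> (nat \<Rightarrow> nat \<Rightarrow> nat) \<Rightarrow> nat \<Rightarrow> col" where
  "row_bits g R k = (g (R 0 k), g (R 1 k), g (R 2 k), g (R 3 k))"

lemma pr_row_bits: "i \<in> Sigma4 \<Longrightarrow> pr i (row_bits g R k) = g (R i k)"
  by (auto simp: Sigma4_def row_bits_def)

lemma build_row_in_vecs: "i \<in> Sigma4 \<Longrightarrow> build_row n U V i \<in> vecs {0..n}"
  by (auto simp: build_row_def)

lemma op_graph_build_row:
  assumes "semi_form n L f" "i \<in> Sigma4"
  shows "op_graph n f (build_row n U V i) \<longleftrightarrow>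
    (\<Sum>k=1..n. pr i (U k)) = hi i \<and> (\<Sum>k=1..n. pr i (V k)) = lo i + L (row_set n U i)"
proof -
  have hi: "(\<Sum>k=0..n. hi (build_row n U V i k)) = hi i + (\<Sum>k=1..n. pr i (U k))"
    by (simp add: sum.atLeast_Suc_atMost build_row_def)
  have lo: "(\<Sum>k=0..n. lo (build_row n U V i k)) = lo i + (\<Sum>k=1..n. pr i (V k))"
    by (simp add: sum.atLeast_Suc_atMost build_row_def)
  have row: "{k \<in> {1..n}. hi (build_row n U V i k) = 1} = row_set n U i"
    by (auto simp: build_row_def row_set_def)
  have bits: "a + b = 0 \<longleftrightarrow> b = a" "a + b = c \<longleftrightarrow> b = a + c" for a b c :: bit
    by (cases a; cases b; cases c; simp)+
  show ?thesis
    using assms(1) build_row_in_vecs[OF assms(2), of n U V]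
    unfolding semi_form_def by (simp only: hi lo row bits add_0_right)
qed

text \<open>Column 0 contributes \<open>(0,0,1,1)\<close> to the high bits and
  \<open>(0,1,0,1)\<close> to the low bits; both are moved to the right-hand sides.\<close>

lemma op_graph_build_rows:
  assumes "semi_form n L f"
  shows "(\<forall>i\<in>Sigma4. op_graph n f (build_row n U V i)) \<longleftrightarrow>
    (\<Sum>k=1..n. U k) = (0,0,1,1) \<and> (\<Sum>k=1..n. V k) = (0,1,0,1) + row_vals n L U"
  unfolding col_eq_iff
  by (auto simp: op_graph_build_row[OF assms] pr_sum pr_add pr_hi pr_lo pr_row_vals)

lemma build_row_inverse:
  assumes "R \<in> Sigma4 \<rightarrow>\<^sub>E vecs {0..n}" "i \<in> Sigma4" "R i 0 = i"
  shows "build_row n (\<lambda>k\<in>{1..n}. row_bits hi R k) (\<lambda>k\<in>{1..n}. row_bits lo R k) i = R i"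
proof
  fix k
  have R: "R i \<in> vecs {0..n}" using assms by blast
  then have "R i k \<in> Sigma4" if "k \<le> n" using that by auto
  moreover have "R i k = undefined" if "\<not> k \<le> n"
    using R that by (simp add: PiE_def extensional_def)
  ultimately show "build_row n (\<lambda>k\<in>{1..n}. row_bits hi R k) (\<lambda>k\<in>{1..n}. row_bits lo R k) i k = R i k"
    using assms by (auto simp: build_row_def pr_row_bits)
qed

text \<open>A transversal is a choice of high columns followed by a choice of low columns among
  their partners. As \<open>L\<close> sees only high bits, the required sum of the low columns is
  fixed once \<open>U\<close> is.\<close>

lemma card_ordered_transversals:
  assumes "semi_form n L f"
  shows "card (ordered_transversals n f) =
    (\<Sum>U\<in>upper_cols n. card (sum_solutions n (\<lambda>k. partners (U k)) ((0,1,0,1) + row_vals n L U)))"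
proof -
  let ?S = "SIGMA U:upper_cols n. sum_solutions n (\<lambda>k. partners (U k)) ((0,1,0,1) + row_vals n L U)"
  let ?G = "\<lambda>(U, V). \<lambda>i\<in>Sigma4. build_row n U V i"
  let ?F = "\<lambda>R. (\<lambda>k\<in>{1..n}. row_bits hi R k, \<lambda>k\<in>{1..n}. row_bits lo R k)"
  \<comment> \<open>Membership is restated row by row, in the shape of
    \<open>ordered_transversals\<close>.\<close>
  have S: "(U, V) \<in> ?S \<longleftrightarrow> U \<in> extensional {1..n} \<and> V \<in> extensional {1..n} \<and>
      (\<forall>k\<in>{1..n}. inj_on (\<lambda>i. mk (pr i (U k)) (pr i (V k))) Sigma4) \<and>
      (\<forall>i\<in>Sigma4. op_graph n f (build_row n U V i))" for U V
    unfolding op_graph_build_rows[OF assms] partner_iff_distinct[symmetric]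
    by (auto simp: sum_solutions_def PiE_def Pi_def)
  have "bij_betw ?G ?S (ordered_transversals n f)"
  proof (rule bij_betw_byWitness[where f' = ?F])
    have "?F (?G (U, V)) = (U, V)" if "(U, V) \<in> ?S" for U V
    proof -
      have "row_bits hi (?G (U, V)) k = U k" "row_bits lo (?G (U, V)) k = V k" if "k \<in> {1..n}" for k
        using that by (auto simp: col_eq_iff pr_row_bits build_row_def)
      then show ?thesis
        using that unfolding S by (auto simp: fun_eq_iff extensional_def)
    qed
    then show "\<forall>a\<in>?S. ?F (?G a) = a" by (metis (no_types, lifting) surj_pair)
    show "\<forall>R\<in>ordered_transversals n f. ?G (?F R) = R"
    proof
      fix R assume R: "R \<in> ordered_transversals n f"
      then have "R \<in> Sigma4 \<rightarrow>\<^sub>E vecs {0..n}" by (simp add: ordered_transversals_def)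
      then show "?G (?F R) = R"
        using R build_row_inverse[of R n] PiE_arb[of R Sigma4]
        by (intro ext) (auto simp: ordered_transversals_def restrict_def)
    qed
    show "?G ` ?S \<subseteq> ordered_transversals n f"
    proof (rule image_subsetI)
      fix UV assume UV: "UV \<in> ?S"
      obtain U V where UV_eq: "UV = (U, V)" by (cases UV)
      with UV have *: "\<And>k. k \<in> {1..n} \<Longrightarrow> inj_on (\<lambda>i. mk (pr i (U k)) (pr i (V k))) Sigma4"
        "\<And>i. i \<in> Sigma4 \<Longrightarrow> op_graph n f (build_row n U V i)"
        unfolding UV_eq S by auto
      have "inj_on (\<lambda>i. (\<lambda>i\<in>Sigma4. build_row n U V i) i k) Sigma4" if "k \<in> {1..n}" for k
        using *(1)[OF that] that by (auto simp: inj_on_def build_row_def)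
      then have "(\<lambda>i\<in>Sigma4. build_row n U V i) \<in> ordered_transversals n f"
        unfolding ordered_transversals_def using *(2) build_row_in_vecs
        by (auto simp: build_row_def)
      then show "?G UV \<in> ordered_transversals n f" by (simp add: UV_eq)
    qed
    show "?F ` ordered_transversals n f \<subseteq> ?S"
    proof (rule image_subsetI)
      fix R assume R: "R \<in> ordered_transversals n f"
      then have R1: "R \<in> Sigma4 \<rightarrow>\<^sub>E vecs {0..n}" and R2: "\<And>i. i \<in> Sigma4 \<Longrightarrow> R i 0 = i"
        and R3: "\<And>i. i \<in> Sigma4 \<Longrightarrow> op_graph n f (R i)"
        and R4: "\<And>k. k \<in> {1..n} \<Longrightarrow> inj_on (\<lambda>i. R i k) Sigma4"
        by (auto simp: ordered_transversals_def)
      have "inj_on (\<lambda>i. mk (pr i (row_bits hi R k)) (pr i (row_bits lo R k))) Sigma4" if k: "k \<in> {1..n}" for k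
      proof -
        have "R i k \<in> Sigma4" if "i \<in> Sigma4" for i
          using PiE_mem[OF PiE_mem[OF R1 that], of k] k by simp
        then have "mk (pr i (row_bits hi R k)) (pr i (row_bits lo R k)) = R i k" if "i \<in> Sigma4" for i
          using that by (simp add: pr_row_bits)
        then show ?thesis using R4[OF k] by (simp cong: inj_on_cong)
      qed
      moreover have "\<forall>i\<in>Sigma4. op_graph n f
          (build_row n (\<lambda>k\<in>{1..n}. row_bits hi R k) (\<lambda>k\<in>{1..n}. row_bits lo R k) i)"
        using R2 R3 build_row_inverse[OF R1] by metis
      ultimately show "?F R \<in> ?S"
        unfolding S by simp
    qed
  qed
  then have "card (ordered_transversals n f) = card ?S"
    by (simp add: bij_betw_same_card)
  also have "\<dots> = (\<Sum>U\<in>upper_cols n. card (sum_solutions n (\<lambda>k. partners (U k)) ((0,1,0,1) + row_vals n L U)))"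
    by (intro card_SigmaI) (auto simp: finite_sum_solutions)
  finally show ?thesis .
qed

section \<open>The number of transversals as a count of high columns\<close>

definition balanced_rows :: "nat \<Rightarrow> (nat set \<Rightarrow> bit) \<Rightarrow> (nat \<Rightarrow> col) set" where
  "balanced_rows n L = {U \<in> upper_cols n. row_vals n L U \<in> even_cols}"

text \<open>The exceptional high columns; by \<open>const_type_upper_cols\<close> no type other than
  that of \<open>(0,0,1,1)\<close> can occur.\<close>

definition const_cols :: "nat \<Rightarrow> (nat \<Rightarrow> col) set" where
  "const_cols n = sum_solutions n (\<lambda>_. {(0,0,1,1), (1,1,0,0)}) (0,0,1,1)"

lemma const_cols_iff: "U \<in> const_cols n \<longleftrightarrow> U \<in> upper_cols n \<and> const_type n U (0,0,1,1)"
  by (auto simp: const_cols_def sum_solutions_def const_type_def PiE_def Pi_def bal_def ones_def)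

text \<open>The four listed columns are closed under addition.\<close>

lemma sum_const_type:
  assumes "t \<in> bal" "const_type n U t"
  shows "(\<Sum>k=1..n. U k) \<in> {0, ones, t, t + ones}"
  using assms(2)
proof (induction n)
  case (Suc n)
  then have IH: "(\<Sum>k=1..n. U k) \<in> {0, ones, t, t + ones}" and U: "U (Suc n) \<in> {t, t + ones}"
    by (auto simp: const_type_def)
  have dbl: "w + w = 0" "w + (w + w') = w'" for w w' :: col
    by (cases w; cases w'; simp add: zero_prod_def add.assoc[symmetric])+
  show ?case
    using IH U by (auto simp: dbl add_ac)
qed simp

text \<open>The sum \<open>(0,0,1,1)\<close> must lie in the subgroup generated by \<open>t\<close>
  and \<open>ones\<close>, which forces \<open>t\<close> up to complement.\<close>

lemma const_type_upper_cols:
  assumes "U \<in> upper_cols n" "t \<in> bal" "const_type n U t"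
  shows "const_type n U (0,0,1,1)"
proof -
  have "(0,0,1,1) \<in> {0, ones, t, t + ones}"
    using sum_const_type[OF assms(2,3)] assms(1) by (simp add: sum_solutions_def)
  with assms(2) have "t = (0,0,1,1) \<or> t = (1,1,0,0)"
    by (elim bal_cases) (simp_all add: ones_def zero_prod_def)
  then show ?thesis
    using assms(3) by (auto simp: const_type_def ones_def zero_prod_def)
qed

text \<open>An even number of columns from \<open>{(0,0,1,1), (1,1,0,0)}\<close> adds up to
  \<open>0\<close> or \<open>ones\<close>, never to \<open>(0,0,1,1)\<close>.\<close>

lemma const_cols_odd:
  assumes "U \<in> const_cols n" shows "odd n"
proof (cases "n \<ge> 1")
  case True
  show ?thesis
  proof (rule ccontr)
    assume "\<not> odd n"
    then have "card (const_cols n) = 0"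
      using card_const_solutions[OF True, of "(0,0,1,1)"]
      by (simp add: const_cols_def ones_def zero_prod_def)
    moreover have "finite (const_cols n)"
      by (simp add: const_cols_def finite_sum_solutions)
    ultimately show False
      using assms by (metis card_0_eq empty_iff)
  qed
next
  case False
  then show ?thesis using assms by (auto simp: const_cols_def sum_solutions_def zero_prod_def)
qed

text \<open>Every column agrees in rows 0 and 1 and in rows 2 and 3, so these rows share their
  supports and \<open>L\<close> cancels in pairs.\<close>

lemma row_vals_const_cols:
  assumes "U \<in> const_cols n"
  obtains a b where "row_vals n L U = (a, a, b, b)"
proof -
  have U: "U k \<in> {(0,0,1,1), (1,1,0,0)}" if "k \<in> {1..n}" for k
    using assms PiE_mem[of U "{1..n}" "\<lambda>_. {(0,0,1,1), (1,1,0,0)}" k] that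
    by (auto simp: const_cols_def sum_solutions_def)
  have "row_set n U 1 = row_set n U 0" "row_set n U 3 = row_set n U 2"
    using U unfolding row_set_def by fastforce+
  then show ?thesis using that unfolding row_vals_def by metis
qed

lemma const_cols_subset: "const_cols n \<subseteq> balanced_rows n L"
proof
  fix U assume U: "U \<in> const_cols n"
  obtain a b where "row_vals n L U = (a, a, b, b)" using row_vals_const_cols[OF U] .
  then have "row_vals n L U \<in> even_cols"
    by (simp add: even_cols_def ones_def add.assoc)
  then show "U \<in> balanced_rows n L"
    using U by (simp add: balanced_rows_def const_cols_iff)
qed

lemma finite_upper_cols: "finite (upper_cols n)"
  by (simp add: finite_sum_solutions)

text \<open>A member of \<open>balanced_rows\<close> contributes \<open>4 ^ n / 8\<close>, a member
  of \<open>const_cols\<close> twice as much. Since the latter set is contained in the former,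
  adding the two cardinalities gives the right weights.\<close>

lemma num_transversals_semi_form:
  assumes "semi_form n L f" "n \<ge> 1"
  shows "8 * num_transversals n f = 4 ^ n * (card (balanced_rows n L) + card (const_cols n))"
proof -
  let ?c = "\<lambda>U. card (sum_solutions n (\<lambda>k. partners (U k)) ((0,1,0,1) + row_vals n L U))"
  have c: "8 * ?c U = 4 ^ n * (of_bool (U \<in> balanced_rows n L) + of_bool (U \<in> const_cols n))"
    if U: "U \<in> upper_cols n" for U
  proof (cases "U \<in> const_cols n")
    case True
    obtain a b where ab: "row_vals n L U = (a, a, b, b)" using row_vals_const_cols[OF True] .
    \<comment> \<open>Here \<open>dot (0,0,1,1)\<close> of the target is
      \<open>b + (1 + b) = 1\<close>, which matches \<open>of_nat n\<close> as \<open>n\<close> is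
      odd.\<close>
    have "(0,1,0,1) + row_vals n L U \<in> type_coset (0,0,1,1) n"
      using const_cols_odd[OF True] unfolding ab
      by (cases a; cases b)
         (auto simp: type_coset_def even_cols_def ones_def of_nat_bit_eq_0_iff simp flip: bit_not_zero_iff)
    then have "4 * ?c U = 4 ^ n"
      using card_partner_solutions_const[of "(0,0,1,1)" n U "(0,1,0,1) + row_vals n L U"] True assms(2)
      by (simp add: const_cols_iff const_type_def bal_def)
    then show ?thesis using True const_cols_subset by auto
  next
    case False
    have "(0,1,0,1) + w \<in> even_cols \<longleftrightarrow> w \<in> even_cols" for w
      by (cases w) (auto simp: even_cols_def ones_def add_ac)
    then have "8 * ?c U = 4 ^ n * of_bool (row_vals n L U \<in> even_cols)"
    proof (subst card_partner_solutions_nonconst)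
      show "\<not> const_type n U t" if "t \<in> bal" for t
        using const_type_upper_cols[OF U that] False U by (auto simp: const_cols_iff)
      show "U k \<in> bal" if "k \<in> {1..n}" for k
        using U that PiE_mem[of U "{1..n}" "\<lambda>_. bal" k] by (auto simp: sum_solutions_def)
    qed simp
    then show ?thesis
      using False U by (simp add: balanced_rows_def)
  qed
  have "8 * num_transversals n f = (\<Sum>U\<in>upper_cols n. 8 * ?c U)"
    unfolding num_transversals_eq_card_ordered card_ordered_transversals[OF assms(1)]
    by (simp add: sum_distrib_left)
  also have "\<dots> = (\<Sum>U\<in>upper_cols n. 4 ^ n * (of_bool (U \<in> balanced_rows n L) + of_bool (U \<in> const_cols n)))"
    by (rule sum.cong) (use c in auto)
  also have "\<dots> = 4 ^ n * ((\<Sum>U\<in>upper_cols n. of_bool (U \<in> balanced_rows n L)) + (\<Sum>U\<in>upper_cols n. of_bool (U \<in> const_cols n)))"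
    by (simp only: sum_distrib_left[symmetric] sum.distrib)
  also have "(\<Sum>U\<in>upper_cols n. of_bool (U \<in> balanced_rows n L)) = card (balanced_rows n L)"
    using finite_upper_cols[of n] by (auto simp: balanced_rows_def intro!: arg_cong[where f = card])
  also have "(\<Sum>U\<in>upper_cols n. of_bool (U \<in> const_cols n)) = card (const_cols n)"
    using finite_upper_cols[of n] by (auto simp: const_cols_iff intro!: arg_cong[where f = card])
  finally show ?thesis .
qed


subsection \<open>Functions summing to zero over all admissible quadruples\<close>

definition parity :: "nat \<Rightarrow> nat set \<Rightarrow> bit" where
  "parity n S = (\<Sum>k=1..n. of_bool (k \<in> S))"

text \<open>
  The parity of a row is its \<open>0\<close>-th high bit, so the parity condition is the balance of column \<open>0\<close>.
\<close>

definition quad :: "nat \<Rightarrow> nat set \<Rightarrow> nat set \<Rightarrow> nat set \<Rightarrow> nat set \<Rightarrow> bool" where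
  "quad n A B C D \<longleftrightarrow> A \<subseteq> {1..n} \<and> B \<subseteq> {1..n} \<and> C \<subseteq> {1..n} \<and> D \<subseteq> {1..n} \<and>
     (parity n A, parity n B, parity n C, parity n D) \<in> bal \<and>
     (\<forall>k\<in>{1..n}. (of_bool (k \<in> A), of_bool (k \<in> B), of_bool (k \<in> C), of_bool (k \<in> D)) \<in> bal)"

lemma bal_perms:
  "(a, b, c, d) \<in> bal \<Longrightarrow> (b, a, c, d) \<in> bal" "(a, b, c, d) \<in> bal \<Longrightarrow> (a, c, b, d) \<in> bal"
  "(a, b, c, d) \<in> bal \<Longrightarrow> (a, b, d, c) \<in> bal"
  by (auto simp: bal_def)

lemma quad_perms:
  "quad n A B C D \<Longrightarrow> quad n B A C D" "quad n A B C D \<Longrightarrow> quad n A C B D" "quad n A B C D \<Longrightarrow> quad n A B D C"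
  unfolding quad_def by (blast intro: bal_perms(1)) (blast intro: bal_perms(2), blast intro: bal_perms(3))

text \<open>The indicator columns of the four sets form a member of \<open>upper_cols\<close> whose
  rows have exactly these supports.\<close>

lemma quad_sum_ordered:
  assumes "balanced_rows n L = upper_cols n" "quad n A B C D"
    "(parity n A, parity n B, parity n C, parity n D) = (0,0,1,1)"
  shows "L A + L B + L C + L D = 0"
proof -
  define U :: "nat \<Rightarrow> col" where
    "U = (\<lambda>k\<in>{1..n}. (of_bool (k \<in> A), of_bool (k \<in> B), of_bool (k \<in> C), of_bool (k \<in> D)))"
  have "(\<Sum>k=1..n. U k) = (\<Sum>k=1..n. (of_bool (k \<in> A), of_bool (k \<in> B), of_bool (k \<in> C), of_bool (k \<in> D)))"
    by (rule sum.cong) (auto simp: U_def)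
  also have "\<dots> = (0,0,1,1)"
    using assms(3) by (simp add: sum_prod parity_def)
  finally have "U \<in> upper_cols n"
    using assms(2) by (auto simp: sum_solutions_def quad_def U_def)
  then have ev: "row_vals n L U \<in> even_cols"
    using assms(1) by (auto simp: balanced_rows_def)
  have "row_set n U 0 = A" "row_set n U 1 = B" "row_set n U 2 = C" "row_set n U 3 = D"
    using assms(2) by (auto simp: row_set_def U_def quad_def)
  then show ?thesis
    using ev by (simp add: row_vals_def even_cols_def ones_def)
qed

lemma quad_sum:
  assumes "balanced_rows n L = upper_cols n" "quad n A B C D"
  shows "L A + L B + L C + L D = 0"
proof -
  note ord = quad_sum_ordered[OF assms(1)]
  \<comment> \<open>One ordering for each of the six parity patterns in \<open>bal\<close>, with the
    two sets of even parity first.\<close>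
  have q: "quad n A B C D" "quad n C D A B" "quad n A C B D" "quad n B D A C" "quad n A D B C" "quad n B C A D"
    by (rule assms(2),
        rule quad_perms(2)[OF quad_perms(3)[OF quad_perms(1)[OF quad_perms(2)[OF assms(2)]]]],
        rule quad_perms(2)[OF assms(2)],
        rule quad_perms(2)[OF quad_perms(3)[OF quad_perms(1)[OF assms(2)]]],
        rule quad_perms(2)[OF quad_perms(3)[OF assms(2)]],
        rule quad_perms(2)[OF quad_perms(1)[OF assms(2)]])
  have "(parity n A, parity n B, parity n C, parity n D) \<in> bal"
    using assms(2) by (simp add: quad_def)
  then show ?thesis
    by (elim bal_cases)
       (use q[THEN ord] in \<open>simp_all add: add_ac\<close>)
qed

abbreviation symdiff :: "nat set \<Rightarrow> nat set \<Rightarrow> nat set" where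
  "symdiff A B \<equiv> (A - B) \<union> (B - A)"

lemma parity_symdiff: "parity n (symdiff A B) = parity n A + parity n B"
  unfolding parity_def sum.distrib[symmetric] by (rule sum.cong) auto

lemma parity_compl: "parity n ({1..n} - A) = parity n A + of_nat n"
proof -
  have "parity n ({1..n} - A) = (\<Sum>k=1..n. of_bool (k \<in> A) + 1)"
    unfolding parity_def by (rule sum.cong) auto
  then show ?thesis by (simp add: sum.distrib parity_def)
qed

lemma parity_card: "A \<subseteq> {1..n} \<Longrightarrow> parity n A = of_nat (card A)"
  by (simp add: parity_def Int_absorb1)

text \<open>Toggling three elements makes the parities of \<open>S\<close> and \<open>T\<close>
  opposite, which balances column 0. Both quadruples contain the complements of \<open>S\<close> and
  \<open>T\<close>, so these cancel when the two relations are added.\<close>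

lemma triple_quads:
  assumes "S \<subseteq> {1..n}" "i \<in> {1..n}" "j \<in> {1..n}" "k \<in> {1..n}" "distinct [i, j, k]"
  defines "T \<equiv> symdiff S {i, j, k}"
  shows "quad n S ({1..n} - S) T ({1..n} - T)"
    and "quad n ({1..n} - T) ({1..n} - S) (symdiff S {i}) (symdiff S {j, k})"
proof -
  have p: "parity n {i, j, k} = 1" "parity n {i} = 1" "parity n {j, k} = 0"
    using assms by (auto simp: parity_card)
  have T: "parity n T = parity n S + 1"
    unfolding T_def parity_symdiff p ..
  have ijk: "i \<noteq> j" "i \<noteq> k" "j \<noteq> k" using assms(5) by auto
  show "quad n S ({1..n} - S) T ({1..n} - T)"
    unfolding quad_def
  proof (intro conjI ballI)
    show "(parity n S, parity n ({1..n} - S), parity n T, parity n ({1..n} - T)) \<in> bal"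
      unfolding parity_compl T by (cases "parity n S"; cases "of_nat n :: bit") (simp_all add: bal_def)
    fix m assume "m \<in> {1..n}"
    then show "(of_bool (m \<in> S), of_bool (m \<in> {1..n} - S), of_bool (m \<in> T), of_bool (m \<in> {1..n} - T)) \<in> bal"
      by (cases "m \<in> S"; cases "m \<in> T") (simp_all add: bal_def)
  qed (use assms in auto)
  show "quad n ({1..n} - T) ({1..n} - S) (symdiff S {i}) (symdiff S {j, k})"
    unfolding quad_def
  proof (intro conjI ballI)
    show "(parity n ({1..n} - T), parity n ({1..n} - S), parity n (symdiff S {i}), parity n (symdiff S {j, k})) \<in> bal"
      unfolding parity_compl T parity_symdiff p
      by (cases "parity n S"; cases "of_nat n :: bit") (simp_all add: bal_def)
    fix m assume "m \<in> {1..n}"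
    then show "(of_bool (m \<in> {1..n} - T), of_bool (m \<in> {1..n} - S), of_bool (m \<in> symdiff S {i}),
        of_bool (m \<in> symdiff S {j, k})) \<in> bal"
      using ijk unfolding T_def
      by (cases "m \<in> S"; cases "m = i"; cases "m = j"; cases "m = k") (simp_all add: bal_def)
  qed (use assms in auto)
qed

text \<open>In this form, the increment of \<open>L\<close> at \<open>i\<close> is insensitive to
  toggling a pair of other elements, so it can depend on the set only through a parity.\<close>

lemma triple_sum:
  assumes "balanced_rows n L = upper_cols n"
    and "S \<subseteq> {1..n}" "i \<in> {1..n}" "j \<in> {1..n}" "k \<in> {1..n}" "distinct [i, j, k]"
  shows "L S + L (symdiff S {i}) + L (symdiff S {j, k}) + L (symdiff S {i, j, k}) = 0"
proof -
  have cancel: "a + b + c + d = 0 \<Longrightarrow> d + b + e + f = 0 \<Longrightarrow> a + e + f + c = 0" for a b c d e f :: bit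
    by (cases a; cases b; cases c; cases d; cases e; cases f) simp_all
  show ?thesis
    by (rule cancel[OF triple_quads[THEN quad_sum[OF assms(1)], OF assms(2-)]])
qed

text \<open>Here \<open>a i\<close> is the increment at the empty set and \<open>c\<close> the mixed
  second difference, the same for all pairs. The increment of \<open>L\<close> at \<open>u\<close>
  is \<open>a i + c * of_nat (card u)\<close>; adding the \<open>m\<close> elements of a set one by
  one accumulates \<open>c\<close> times \<open>0 + 1 + ... + (m - 1)\<close>, which has the parity
  of \<open>m div 2\<close>.\<close>

lemma balanced_rows_imp_quadratic:
  assumes H: "balanced_rows n L = upper_cols n" and "n \<ge> 1"
  obtains c0 a c where "\<And>S. S \<subseteq> {1..n} \<Longrightarrow> L S = c0 + (\<Sum>i\<in>S. a i) + c * of_nat (card S div 2)"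
    and "even n \<Longrightarrow> c = 0"
proof -
  define a where "a i = L {} + L {i}" for i
  define c2 where "c2 i j = L {} + L {i} + L {j} + L {i, j}" for i j
  \<comment> \<open>The pair \<open>1, 2\<close> serves as reference; for \<open>n = 1\<close> there
    are no pairs.\<close>
  define c where "c = (if n \<ge> 2 then c2 1 2 else 0)"
  note tri = triple_sum[OF H]
  have sym: "c2 i j = c2 j i" for i j
    by (simp add: c2_def insert_commute add_ac)
  have c2_eq: "c2 i j = c2 i k" if "i \<in> {1..n}" "j \<in> {1..n}" "k \<in> {1..n}" "distinct [i, j, k]" for i j k
  proof -
    have "symdiff {j} {i} = {i, j}" "symdiff {j} {j, k} = {k}" "symdiff {j} {i, j, k} = {i, k}"
      using that by auto
    then have "L {j} + L {i, j} + L {k} + L {i, k} = 0"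
      using tri[of "{j}" i j k] that by simp
    moreover have "p + q + r + s = 0 \<Longrightarrow> x + y + p + q = x + y + r + s" for p q r s x y :: bit
      by (cases p; cases q; cases r; cases s) simp_all
    ultimately show ?thesis unfolding c2_def by blast
  qed
  have c2: "c2 i j = c" if ij: "i \<in> {1..n}" "j \<in> {1..n}" "i \<noteq> j" for i j
  proof -
    have n: "n \<ge> 2" using ij by auto
    have one: "c2 1 j = c" if "j \<in> {1..n}" "j \<noteq> 1" for j
      using c2_eq[of 1 j 2] that n by (cases "j = 2") (auto simp: c_def)
    show ?thesis
    proof (cases "i = 1 \<or> j = 1")
      case True
      then show ?thesis using one ij sym by metis
    next
      case False
      then have "c2 i j = c2 i 1" using c2_eq[of i j 1] ij n by auto
      then show ?thesis using one[of i] sym False ij by metis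
    qed
  qed
  \<comment> \<open>Strong induction removes two elements of \<open>u\<close> at a time; sizes 0 and
    1 are the definitions of \<open>a\<close> and the constancy of \<open>c2\<close>.\<close>
  have step: "L (insert i u) = L u + a i + c * of_nat (card u)" if "u \<subseteq> {1..n}" "i \<in> {1..n}" "i \<notin> u" for i u
    using that
  proof (induction "card u" arbitrary: u rule: less_induct)
    case less
    have fin: "finite u" using less.prems(1) finite_subset by blast
    consider "card u = 0" | "card u = 1" | "card u \<ge> 2" by linarith
    then show ?case
    proof cases
      case 1
      then have "u = {}" using fin by simp
      then show ?thesis by (simp add: a_def add.assoc[symmetric])
    next
      case 2
      then obtain j where u: "u = {j}" by (auto simp: card_1_singleton_iff)
      have e: "L {} + L {i} + L {j} + L {i, j} = c"
        using c2[of i j] less.prems u by (auto simp: c2_def)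
      have "p + q + r + s = t \<Longrightarrow> s = r + (p + q) + t" for p q r s t :: bit
        by (cases p; cases q; cases r; cases s) auto
      from this[OF e] show ?thesis by (simp add: u a_def)
    next
      case 3
      then obtain j where j: "j \<in> u" by force
      then obtain k where k: "k \<in> u" "k \<noteq> j"
        using 3 fin by (metis card_le_Suc0_iff_eq not_less_eq_eq numeral_2_eq_2)
      let ?v = "u - {j, k}"
      have cv: "card u = card ?v + 2"
        using j k fin 3 by (simp add: card_Diff_subset)
      have "symdiff ?v {i} = insert i ?v" "symdiff ?v {j, k} = u" "symdiff ?v {i, j, k} = insert i u"
        using j k less.prems by auto
      moreover have "distinct [i, j, k]" "j \<in> {1..n}" "k \<in> {1..n}" "?v \<subseteq> {1..n}" using j k less.prems by auto
      ultimately have s: "L ?v + L (insert i ?v) + L u + L (insert i u) = 0"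
        using tri[of ?v i j k] less.prems by simp
      have IH: "L (insert i ?v) = L ?v + a i + c * of_nat (card ?v)"
        by (rule less.hyps) (use cv less.prems in auto)
      have "p + (p + x + y) + q + r = 0 \<Longrightarrow> r = q + x + y" for p q r x y :: bit
        by (cases p; cases q; cases r; cases x; cases y) simp_all
      from this[OF s[unfolded IH]] show ?thesis
        by (simp add: cv)
    qed
  qed
  have form: "L S = L {} + (\<Sum>i\<in>S. a i) + c * of_nat (card S div 2)" if "S \<subseteq> {1..n}" for S
  proof -
    have "finite S" using that finite_subset by blast
    then show ?thesis using that
    proof induction
      case (insert i S)
      have "L (insert i S) = (L {} + sum a S + c * of_nat (card S div 2)) + a i + c * of_nat (card S)"
        using step[of S i] insert by simp
      also have "\<dots> = L {} + (a i + sum a S) + c * of_nat (Suc (card S) div 2)"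
        unfolding of_nat_half_Suc by (simp add: algebra_simps)
      finally show ?case using insert by simp
    qed simp
  qed
  have "c = 0" if "even n"
  proof -
    have n: "n \<ge> 2" using that assms(2) by (cases "n = 1") auto
    define m where "m = n - 1"
    have m: "n = Suc m" "odd m" "m \<ge> 1" using n that by (auto simp: m_def)
    \<comment> \<open>Together with \<open>{}\<close> these sets have sizes 0, \<open>m\<close>, 2,
      \<open>m\<close>. Each \<open>a i\<close> occurs an even number of times, the two terms for
      size \<open>m\<close> cancel, and only the \<open>c\<close> of the pair survives.\<close>
    let ?B = "{1..m}" and ?C = "{m, n}" and ?D = "{1..n} - {m}"
    have cards: "card ?C = 2" "card ?D = m" using m by auto
    have "quad n {} ?B ?C ?D"
      unfolding quad_def
    proof (intro conjI ballI)
      have "parity n ?B = of_nat m" "parity n ?C = 0" "parity n ?D = of_nat m" "parity n {} = 0"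
        using m cards by (simp_all add: parity_card)
      then show "(parity n {}, parity n ?B, parity n ?C, parity n ?D) \<in> bal"
        using m(2) of_nat_bit_eq_0_iff[of m] by (simp add: bal_def)
      fix k assume "k \<in> {1..n}"
      then show "(of_bool (k \<in> {}), of_bool (k \<in> ?B), of_bool (k \<in> ?C), of_bool (k \<in> ?D)) \<in> bal"
        using m by (cases "k = m"; cases "k = n") (auto simp: bal_def)
    qed (use m in auto)
    then have "L {} + L ?B + L ?C + L ?D = 0" by (rule quad_sum[OF H])
    moreover have "L ?B = L {} + sum a ?B + c * of_nat (m div 2)"
      using form[of ?B] m by simp
    moreover have "L ?C = L {} + (a m + a n) + c"
      using form[of ?C] m cards by simp
    moreover have "sum a ?D = sum a {1..m - 1} + a n"
    proof -
      have "?D = insert n {1..m - 1}" using m by auto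
      then show ?thesis using m by (simp add: add.commute)
    qed
    moreover have "sum a ?B = sum a {1..m - 1} + a m"
      using m(3) by (cases m) auto
    moreover have "L ?D = L {} + sum a ?D + c * of_nat (m div 2)"
      using form[of ?D] cards by auto
    moreover have "l + (l + (s + x) + d) + (l + (x + y) + c) + (l + (s + y) + d) = 0 \<Longrightarrow> c = 0"
      for l s x y d c :: bit
      by (cases l; cases s; cases x; cases y; cases d; cases c) simp_all
    ultimately show ?thesis by metis
  qed
  with form show ?thesis using that by blast
qed


subsection \<open>Isotopy\<close>

lemma op_graph_cong:
  assumes "\<And>i. i \<in> {0..n} \<Longrightarrow> x i = y i"
  shows "op_graph n f x \<longleftrightarrow> op_graph n f y"
proof -
  have "restrict x {1..n} = restrict y {1..n}"
    using assms by (intro restrict_ext) auto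
  then show ?thesis using assms[of 0] by (simp add: op_graph_def)
qed

text \<open>On graphs, coordinate 0 is treated like the others, so that isotopies can be inverted,
  composed and applied to transversals coordinatewise.\<close>

lemma isotopic_iff:
  "isotopic n f g \<longleftrightarrow> quasigroup4 n f \<and> quasigroup4 n g \<and>
     (\<exists>\<sigma>. (\<forall>i\<in>{0..n}. \<sigma> i permutes Sigma4) \<and>
        (\<forall>x\<in>vecs {0..n}. op_graph n f x \<longleftrightarrow> op_graph n g (\<lambda>i. \<sigma> i (x i))))"
proof -
  have "(\<forall>x\<in>vecs {1..n}. f x = inv_into UNIV (\<sigma> 0) (g (\<lambda>i\<in>{1..n}. \<sigma> i (x i)))) \<longleftrightarrow>
      (\<forall>x\<in>vecs {0..n}. op_graph n f x \<longleftrightarrow> op_graph n g (\<lambda>i. \<sigma> i (x i)))"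
    if f: "f \<in> vecs {1..n} \<rightarrow> Sigma4" and \<sigma>: "\<forall>i\<in>{0..n}. \<sigma> i permutes Sigma4" for \<sigma>
  proof -
    have \<sigma>0: "\<sigma> 0 permutes Sigma4" using \<sigma> by simp
    have inv: "a = inv_into UNIV (\<sigma> 0) b \<longleftrightarrow> \<sigma> 0 a = b" for a b
      by (subst permutes_inv_eq[OF \<sigma>0, symmetric]) (rule eq_commute)
    show ?thesis
      unfolding inv
    proof safe
      fix x assume x: "x \<in> vecs {0..n}"
        and *: "\<forall>x\<in>vecs {1..n}. \<sigma> 0 (f x) = g (\<lambda>i\<in>{1..n}. \<sigma> i (x i))"
      have "restrict x {1..n} \<in> vecs {1..n}" using x by auto
      then have "\<sigma> 0 (f (restrict x {1..n})) = g (\<lambda>i\<in>{1..n}. \<sigma> i (restrict x {1..n} i))"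
        using * by blast
      also have "(\<lambda>i\<in>{1..n}. \<sigma> i (restrict x {1..n} i)) = restrict (\<lambda>i. \<sigma> i (x i)) {1..n}"
        by (rule restrict_ext) simp
      finally have eq: "\<sigma> 0 (f (restrict x {1..n})) = g (restrict (\<lambda>i. \<sigma> i (x i)) {1..n})" .
      have "inj (\<sigma> 0)" using \<sigma>0 by (rule permutes_inj)
      then have "x 0 = f (restrict x {1..n}) \<longleftrightarrow> \<sigma> 0 (x 0) = \<sigma> 0 (f (restrict x {1..n}))"
        by (simp add: inj_eq)
      then have iff: "op_graph n f x \<longleftrightarrow> op_graph n g (\<lambda>i. \<sigma> i (x i))"
        unfolding op_graph_def eq .
      show "op_graph n g (\<lambda>i. \<sigma> i (x i))" if "op_graph n f x" using iff that by simp
      show "op_graph n f x" if "op_graph n g (\<lambda>i. \<sigma> i (x i))" using iff that by simp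
    next
      fix x assume x: "x \<in> vecs {1..n}"
        and *: "\<forall>x\<in>vecs {0..n}. op_graph n f x = op_graph n g (\<lambda>i. \<sigma> i (x i))"
      let ?y = "x(0 := f x)"
      have "?y \<in> vecs {0..n}" using f x by (auto simp: PiE_def Pi_def extensional_def)
      moreover have r: "restrict ?y {1..n} = x"
        using x by (auto simp: fun_eq_iff PiE_def extensional_def)
      then have "op_graph n f ?y" by (simp add: op_graph_def)
      ultimately have "op_graph n g (\<lambda>i. \<sigma> i (?y i))" using * by blast
      moreover have "restrict (\<lambda>i. \<sigma> i (?y i)) {1..n} = (\<lambda>i\<in>{1..n}. \<sigma> i (x i))"
        by (rule restrict_ext) auto
      ultimately show "\<sigma> 0 (f x) = g (\<lambda>i\<in>{1..n}. \<sigma> i (x i))"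
        by (simp add: op_graph_def)
    qed
  qed
  note key = this
  show ?thesis
    unfolding isotopic_def
    by (intro conj_cong refl iff_exI key) (auto simp only: quasigroup4_def)
qed

lemma restrict_permutes_in_vecs:
  "\<lbrakk>\<forall>i\<in>I. \<sigma> i permutes Sigma4; x \<in> vecs I\<rbrakk> \<Longrightarrow> (\<lambda>i\<in>I. \<sigma> i (x i)) \<in> vecs I"
  by (auto simp: permutes_in_image dest: PiE_mem)

lemma isotopic_sym:
  assumes "isotopic n f g" shows "isotopic n g f"
proof -
  obtain \<sigma> where q: "quasigroup4 n f" "quasigroup4 n g" and \<sigma>: "\<forall>i\<in>{0..n}. \<sigma> i permutes Sigma4"
    and gr: "\<And>x. x \<in> vecs {0..n} \<Longrightarrow> op_graph n f x \<longleftrightarrow> op_graph n g (\<lambda>i. \<sigma> i (x i))"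
    using assms unfolding isotopic_iff by blast
  let ?\<tau> = "\<lambda>i. inv_into UNIV (\<sigma> i)"
  have \<tau>: "\<forall>i\<in>{0..n}. ?\<tau> i permutes Sigma4" using \<sigma> permutes_inv by blast
  have "op_graph n g y \<longleftrightarrow> op_graph n f (\<lambda>i. ?\<tau> i (y i))" if "y \<in> vecs {0..n}" for y
  proof -
    \<comment> \<open>The graph relation is transported only for extensional vectors, hence the
      detour through a restriction.\<close>
    have "op_graph n f (\<lambda>i. ?\<tau> i (y i)) \<longleftrightarrow> op_graph n f (\<lambda>i\<in>{0..n}. ?\<tau> i (y i))"
      by (rule op_graph_cong) simp
    also have "\<dots> \<longleftrightarrow> op_graph n g (\<lambda>i. \<sigma> i ((\<lambda>i\<in>{0..n}. ?\<tau> i (y i)) i))"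
      by (rule gr[OF restrict_permutes_in_vecs[OF \<tau> that]])
    also have "\<dots> \<longleftrightarrow> op_graph n g y"
      by (rule op_graph_cong) (use \<sigma> in \<open>simp add: permutes_inverses(1)[of _ Sigma4]\<close>)
    finally show ?thesis by simp
  qed
  then show ?thesis
    unfolding isotopic_iff using q \<tau> by (intro conjI exI[of _ ?\<tau>]) auto
qed

lemma isotopic_trans:
  assumes "isotopic n f g" "isotopic n g h" shows "isotopic n f h"
proof -
  obtain \<sigma> where q: "quasigroup4 n f" and \<sigma>: "\<forall>i\<in>{0..n}. \<sigma> i permutes Sigma4"
    and gr: "\<And>x. x \<in> vecs {0..n} \<Longrightarrow> op_graph n f x \<longleftrightarrow> op_graph n g (\<lambda>i. \<sigma> i (x i))"
    using assms(1) unfolding isotopic_iff by blast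
  obtain \<tau> where q': "quasigroup4 n h" and \<tau>: "\<forall>i\<in>{0..n}. \<tau> i permutes Sigma4"
    and gr': "\<And>x. x \<in> vecs {0..n} \<Longrightarrow> op_graph n g x \<longleftrightarrow> op_graph n h (\<lambda>i. \<tau> i (x i))"
    using assms(2) unfolding isotopic_iff by blast
  have "op_graph n f x \<longleftrightarrow> op_graph n h (\<lambda>i. (\<tau> i \<circ> \<sigma> i) (x i))" if "x \<in> vecs {0..n}" for x
  proof -
    have "op_graph n f x \<longleftrightarrow> op_graph n g (\<lambda>i. \<sigma> i (x i))" by (rule gr[OF that])
    also have "\<dots> \<longleftrightarrow> op_graph n g (\<lambda>i\<in>{0..n}. \<sigma> i (x i))"
      by (rule op_graph_cong) simp
    also have "\<dots> \<longleftrightarrow> op_graph n h (\<lambda>i. \<tau> i ((\<lambda>i\<in>{0..n}. \<sigma> i (x i)) i))"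
      by (rule gr'[OF restrict_permutes_in_vecs[OF \<sigma> that]])
    also have "\<dots> \<longleftrightarrow> op_graph n h (\<lambda>i. (\<tau> i \<circ> \<sigma> i) (x i))"
      by (rule op_graph_cong) simp
    finally show ?thesis .
  qed
  moreover have "\<forall>i\<in>{0..n}. (\<tau> i \<circ> \<sigma> i) permutes Sigma4"
    using \<sigma> \<tau> permutes_compose by blast
  ultimately show ?thesis
    unfolding isotopic_iff using q q' by (intro conjI exI[of _ "\<lambda>i. \<tau> i \<circ> \<sigma> i"]) auto
qed

text \<open>Coordinatewise permutations act injectively on vectors and carry transversals to
  transversals; symmetry of isotopy then yields equality.\<close>

lemma num_transversals_isotopic_le:
  assumes "isotopic n f g" shows "num_transversals n f \<le> num_transversals n g"
proof -
  obtain \<sigma> where \<sigma>: "\<forall>i\<in>{0..n}. \<sigma> i permutes Sigma4"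
    and gr: "\<And>x. x \<in> vecs {0..n} \<Longrightarrow> op_graph n f x \<longleftrightarrow> op_graph n g (\<lambda>i. \<sigma> i (x i))"
    using assms unfolding isotopic_iff by blast
  define h where "h x = (\<lambda>i\<in>{0..n}. \<sigma> i (x i))" for x
  have \<sigma>_inj: "\<sigma> i a = \<sigma> i b \<longleftrightarrow> a = b" if "i \<in> {0..n}" for i a b
    using \<sigma> that permutes_inj by (metis injD)
  have inj: "inj_on h (vecs {0..n})"
  proof (rule inj_onI)
    fix x y assume xy: "x \<in> vecs {0..n}" "y \<in> vecs {0..n}" "h x = h y"
    show "x = y"
    proof (rule PiE_ext[OF xy(1,2)])
      fix i assume i: "i \<in> {0..n}"
      then have "\<sigma> i (x i) = \<sigma> i (y i)"
        using fun_cong[OF xy(3), of i] by (simp add: h_def)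
      then show "x i = y i" using \<sigma>_inj[OF i] by simp
    qed
  qed
  have "transversal n g (h ` T)" if T: "transversal n f T" for T
    unfolding transversal_def
  proof (intro conjI ballI impI)
    have sub: "T \<subseteq> vecs {0..n}" using T by (simp add: transversal_def)
    show "h ` T \<subseteq> vecs {0..n}"
      unfolding h_def by (intro image_subsetI restrict_permutes_in_vecs[OF \<sigma>]) (use sub in blast)
    show "card (h ` T) = 4"
      using T card_image[OF inj_on_subset[OF inj sub]] by (simp add: transversal_def)
    fix b assume "b \<in> h ` T"
    then obtain a where a: "a \<in> T" "b = h a" by blast
    have "op_graph n g (\<lambda>i. \<sigma> i (a i))"
      using T a(1) gr[of a] sub unfolding transversal_def by blast
    moreover have "op_graph n g (\<lambda>i. \<sigma> i (a i)) \<longleftrightarrow> op_graph n g b"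
      unfolding a(2) h_def by (rule op_graph_cong) simp
    ultimately show "op_graph n g b" by simp
  next
    fix a' b' k assume *: "a' \<in> h ` T" "b' \<in> h ` T" "a' \<noteq> b'" "k \<in> {0..n}"
    then obtain a b where ab: "a \<in> T" "b \<in> T" "a' = h a" "b' = h b" "a \<noteq> b" by blast
    then have "a k \<noteq> b k" using T *(4) unfolding transversal_def by blast
    then show "a' k \<noteq> b' k" using ab *(4) \<sigma>_inj by (simp add: h_def)
  qed
  then have "(\<lambda>T. h ` T) ` {T. transversal n f T} \<subseteq> {T. transversal n g T}" by blast
  moreover have "inj_on (\<lambda>T. h ` T) {T. transversal n f T}"
    by (rule inj_on_subset[OF inj_on_image_Pow[OF inj]]) (auto simp: transversal_def)
  moreover have "finite {T. transversal n g T}"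
    by (rule finite_subset[of _ "Pow (vecs {0..n})"]) (auto simp: transversal_def intro: finite_PiE)
  ultimately show ?thesis
    unfolding num_transversals_def by (intro card_inj_on_le)
qed

lemma num_transversals_isotopic:
  "isotopic n f g \<Longrightarrow> num_transversals n f = num_transversals n g"
  using num_transversals_isotopic_le isotopic_sym by (metis antisym)

section \<open>Quasigroups with prescribed \<open>L\<close> and their normal form\<close>

definition std_op :: "nat \<Rightarrow> (nat set \<Rightarrow> bit) \<Rightarrow> (nat \<Rightarrow> nat) \<Rightarrow> nat" where
  "std_op n L x = mk (\<Sum>i=1..n. hi (x i)) ((\<Sum>i=1..n. lo (x i)) + L {i \<in> {1..n}. hi (x i) = 1})"

lemma op_graph_std_op:
  assumes "x \<in> vecs {0..n}"
  shows "op_graph n (std_op n L) x \<longleftrightarrow>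
    (\<Sum>i=0..n. hi (x i)) = 0 \<and> (\<Sum>i=0..n. lo (x i)) = L {i \<in> {1..n}. hi (x i) = 1}"
proof -
  have x0: "x 0 \<in> Sigma4" using assms by auto
  have eq: "x 0 = mk a b \<longleftrightarrow> hi (x 0) = a \<and> lo (x 0) = b" for a b
    using mk_eq_iff[of "hi (x 0)" "lo (x 0)" a b] unfolding mk_hi_lo[OF x0] .
  have set: "{i \<in> {1..n}. hi (restrict x {1..n} i) = 1} = {i \<in> {1..n}. hi (x i) = 1}"
    by auto
  have bits: "a = b \<longleftrightarrow> a + b = 0" "a = b + c \<longleftrightarrow> a + b = c" for a b c :: bit
    by (cases a; cases b; cases c; simp)+
  have "op_graph n (std_op n L) x \<longleftrightarrow> hi (x 0) = (\<Sum>i=1..n. hi (x i)) \<and>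
      lo (x 0) = (\<Sum>i=1..n. lo (x i)) + L {i \<in> {1..n}. hi (x i) = 1}"
    unfolding op_graph_def std_op_def eq set by simp
  also have "\<dots> \<longleftrightarrow> hi (x 0) + (\<Sum>i=1..n. hi (x i)) = 0 \<and>
      lo (x 0) + (\<Sum>i=1..n. lo (x i)) = L {i \<in> {1..n}. hi (x i) = 1}"
    by (intro conj_cong bits)
  finally show ?thesis by (simp add: sum.atLeast_Suc_atMost)
qed

text \<open>Every \<open>L\<close> is realised: for an unknown entry, the high-bit equation fixes
  its high bit, hence the argument of \<open>L\<close>, and then the low-bit equation fixes its low
  bit.\<close>

lemma semi_form_std_op: "semi_form n L (std_op n L)"
proof -
  have "\<exists>!y. y \<in> Sigma4 \<and> op_graph n (std_op n L) (x(k := y))"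
    if k: "k \<in> {0..n}" and x: "x \<in> vecs {0..n}" for k x
  proof -
    define A where "A = (\<Sum>i\<in>{0..n} - {k}. hi (x i))"
    define B where "B = (\<Sum>i\<in>{0..n} - {k}. lo (x i))"
    \<comment> \<open>The value of \<open>L\<close> when the unknown entry has high bit
      \<open>h\<close>; it is constant for \<open>k = 0\<close>, as \<open>L\<close> ignores
      coordinate 0.\<close>
    define g where "g h = L {i \<in> {1..n}. (if i = k then h else hi (x i)) = 1}" for h
    have bits: "a + b = 0 \<longleftrightarrow> a = b" "a + b = c \<longleftrightarrow> a = b + c" for a b c :: bit
      by (cases a; cases b; cases c; simp)+
    have iff: "op_graph n (std_op n L) (x(k := y)) \<longleftrightarrow> hi y = A \<and> lo y = B + g (hi y)" if y: "y \<in> Sigma4" for y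
    proof -
      have v: "x(k := y) \<in> vecs {0..n}" using x y k by (auto simp: PiE_def Pi_def extensional_def)
      have "(\<Sum>i=0..n. hi ((x(k := y)) i)) = hi y + A" "(\<Sum>i=0..n. lo ((x(k := y)) i)) = lo y + B"
        using k by (auto simp: A_def B_def sum.remove[of _ k] intro!: sum.cong)
      moreover have "{i \<in> {1..n}. hi ((x(k := y)) i) = 1} = {i \<in> {1..n}. (if i = k then hi y else hi (x i)) = 1}"
        by auto
      ultimately show ?thesis
        unfolding op_graph_std_op[OF v] g_def by (simp only: bits add_0_right)
    qed
    show ?thesis
    proof (rule ex1I[of _ "mk A (B + g A)"])
      show "mk A (B + g A) \<in> Sigma4 \<and> op_graph n (std_op n L) (x(k := mk A (B + g A)))"
        by (simp add: iff)
      fix y assume "y \<in> Sigma4 \<and> op_graph n (std_op n L) (x(k := y))"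
      then show "y = mk A (B + g A)"
        using iff[of y] mk_hi_lo[of y] by simp
    qed
  qed
  then have "quasigroup4 n (std_op n L)"
    by (auto simp: quasigroup4_def std_op_def)
  then show ?thesis by (simp add: semi_form_def op_graph_std_op)
qed

text \<open>
  A vector with \<open>\<Sum> hi = 0\<close> and support \<open>S\<close> on \<open>{1..n}\<close> has weight \<open>|S|\<close> or \<open>|S| + 1\<close>, whichever is even;
  \<open>Suc (card S) div 2\<close> is half of it. This is the carry from \<open>hi\<close> into \<open>lo\<close> when \<open>x\<close> is read as
  \<open>hi x + 2 * lo x\<close> in \<open>\<int>\<^sub>4\<close>.
\<close>

definition half_form :: "bit \<Rightarrow> nat set \<Rightarrow> bit" where
  "half_form c S = c * of_nat (Suc (card S) div 2)"

abbreviation std_group_op :: "nat \<Rightarrow> bit \<Rightarrow> (nat \<Rightarrow> nat) \<Rightarrow> nat" where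
  "std_group_op n c \<equiv> std_op n (half_form c)"

lemma sum_over_hi: "(\<Sum>i | i \<in> {1..n} \<and> hi (x i) = 1. b i) = (\<Sum>i=1..n. b i * hi (x i))"
  for b :: "nat \<Rightarrow> bit"
proof -
  have "(\<Sum>i | i \<in> {1..n} \<and> hi (x i) = 1. b i) = (\<Sum>i=1..n. if hi (x i) = 1 then b i else 0)"
    by (simp add: sum.inter_filter[symmetric])
  also have "\<dots> = (\<Sum>i=1..n. b i * hi (x i))"
    by (rule sum.cong) auto
  finally show ?thesis .
qed

text \<open>Adding \<open>c0\<close> to the low bit of coordinate 0 and \<open>b i * hi x\<close> to
  that of coordinate \<open>i\<close> absorbs the affine part. High bits do not change, so neither
  does the argument of \<open>L\<close>.\<close>

lemma quadratic_isotopic_std: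
  assumes "semi_form n L g"
    and L: "\<And>S. S \<subseteq> {1..n} \<Longrightarrow> L S = c0 + (\<Sum>i\<in>S. a i) + c * of_nat (card S div 2)"
  shows "isotopic n g (std_group_op n c)"
proof -
  \<comment> \<open>The extra \<open>c\<close> per element trades \<open>card S div 2\<close> for
    \<open>Suc (card S) div 2\<close>.\<close>
  define b where "b i = a i + c" for i
  define \<sigma> where "\<sigma> i x = (if x \<in> Sigma4 then mk (hi x) (lo x + (if i = 0 then c0 else b i * hi x)) else x)" for i x
  have L': "L S = c0 + (\<Sum>i\<in>S. b i) + half_form c S" if "S \<subseteq> {1..n}" for S
  proof -
    have "(\<Sum>i\<in>S. b i) = (\<Sum>i\<in>S. a i) + c * of_nat (card S)"
      by (simp add: b_def sum.distrib mult.commute)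
    moreover have "p + (q + r) + (s + r) = p + q + s" for p q r s :: bit
      by (cases r) (simp_all add: add_ac)
    ultimately show ?thesis
      by (simp add: L[OF that] half_form_def of_nat_half_Suc distrib_left)
  qed
  have hi\<sigma>: "hi (\<sigma> i x) = hi x" if "x \<in> Sigma4" for i x
    using that by (simp add: \<sigma>_def)
  have lo\<sigma>: "lo (\<sigma> i x) = lo x + (if i = 0 then c0 else b i * hi x)" if "x \<in> Sigma4" for i x
    using that by (simp add: \<sigma>_def)
  have \<sigma>\<sigma>: "\<sigma> i (\<sigma> i x) = x" for i x
    by (cases "x \<in> Sigma4") (simp_all add: \<sigma>_def add.assoc)
  have \<sigma>_in: "\<sigma> i x \<in> Sigma4 \<longleftrightarrow> x \<in> Sigma4" for i x
    by (simp add: \<sigma>_def)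
  have perm: "\<sigma> i permutes Sigma4" for i
  proof (rule bij_imp_permutes)
    show "bij_betw (\<sigma> i) Sigma4 Sigma4"
      by (rule bij_betw_byWitness[where f' = "\<sigma> i"]) (auto simp: \<sigma>\<sigma> \<sigma>_in)
  qed (simp add: \<sigma>_def)
  have "op_graph n g x \<longleftrightarrow> op_graph n (std_group_op n c) (\<lambda>i. \<sigma> i (x i))" if x: "x \<in> vecs {0..n}" for x
  proof -
    let ?y = "\<lambda>i\<in>{0..n}. \<sigma> i (x i)"
    have xi: "x i \<in> Sigma4" if "i \<in> {0..n}" for i using PiE_mem[OF x that] .
    have y: "?y \<in> vecs {0..n}" by (rule restrict_permutes_in_vecs) (use perm x in auto)
    have hi: "(\<Sum>i=0..n. hi (?y i)) = (\<Sum>i=0..n. hi (x i))"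
      by (rule sum.cong) (auto simp: hi\<sigma> xi)
    let ?S = "{i \<in> {1..n}. hi (x i) = 1}"
    have S: "{i \<in> {1..n}. hi (?y i) = 1} = ?S"
      by (auto simp: hi\<sigma> xi)
    have "(\<Sum>i=0..n. lo (?y i)) = (\<Sum>i=0..n. lo (x i) + (if i = 0 then c0 else b i * hi (x i)))"
      by (rule sum.cong) (auto simp: lo\<sigma> xi)
    also have "\<dots> = (\<Sum>i=0..n. lo (x i)) + (c0 + (\<Sum>i=1..n. b i * hi (x i)))"
      by (simp add: sum.distrib sum.atLeast_Suc_atMost[of 0 n "\<lambda>i. if i = 0 then c0 else b i * hi (x i)"])
    also have "(\<Sum>i=1..n. b i * hi (x i)) = (\<Sum>i\<in>?S. b i)"
      by (rule sum_over_hi[symmetric])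
    finally have lo: "(\<Sum>i=0..n. lo (?y i)) = (\<Sum>i=0..n. lo (x i)) + (c0 + (\<Sum>i\<in>?S. b i))" .
    have bits: "p = q + r + s \<longleftrightarrow> p + (q + r) = s" for p q r s :: bit
      by (cases p; cases q; cases r; cases s; simp)
    have "op_graph n g x \<longleftrightarrow> (\<Sum>i=0..n. hi (x i)) = 0 \<and> (\<Sum>i=0..n. lo (x i)) = L ?S"
      using assms(1) x unfolding semi_form_def by blast
    also have "\<dots> \<longleftrightarrow> (\<Sum>i=0..n. hi (?y i)) = 0 \<and>
        (\<Sum>i=0..n. lo (?y i)) = half_form c {i \<in> {1..n}. hi (?y i) = 1}"
      unfolding hi lo S L'[of ?S, OF Collect_restrict] bits ..
    also have "\<dots> \<longleftrightarrow> op_graph n (std_group_op n c) ?y"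
      by (rule op_graph_std_op[OF y, symmetric])
    also have "\<dots> \<longleftrightarrow> op_graph n (std_group_op n c) (\<lambda>i. \<sigma> i (x i))"
      by (rule op_graph_cong) simp
    finally show ?thesis .
  qed
  then show ?thesis
    unfolding isotopic_iff using assms(1) semi_form_std_op[of n "half_form c"] perm
    by (intro conjI exI[of _ \<sigma>]) (auto simp: semi_form_def)
qed


subsection \<open>Iterated groups\<close>

lemma comm_group_Z2sq: "comm_group Z2sq"
proof (rule group.group_comm_groupI)
  show "group Z2sq" by (simp add: DirProd_group)
qed (auto simp: add.commute)

lemma finprod_Z4:
  assumes "finite A" "\<And>i. i \<in> A \<Longrightarrow> u i \<in> carrier Z4"
  shows "finprod Z4 u A = (\<Sum>i\<in>A. u i) mod 4"
proof -
  interpret comm_group Z4 by simp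
  show ?thesis
    using assms
  proof induction
    case (insert a A)
    then have "finprod Z4 u (insert a A) = u a \<otimes>\<^bsub>Z4\<^esub> finprod Z4 u A"
      by (intro finprod_insert) auto
    then show ?case using insert by (simp add: mod_add_right_eq)
  qed simp
qed

lemma finprod_Z2sq:
  assumes "finite A" "\<And>i. i \<in> A \<Longrightarrow> u i \<in> carrier Z2sq"
  shows "finprod Z2sq u A = ((\<Sum>i\<in>A. fst (u i)) mod 2, (\<Sum>i\<in>A. snd (u i)) mod 2)"
proof -
  interpret comm_group Z2sq by (rule comm_group_Z2sq)
  show ?thesis
    using assms
  proof induction
    case (insert a A)
    then have "finprod Z2sq u (insert a A) = u a \<otimes>\<^bsub>Z2sq\<^esub> finprod Z2sq u A"
      by (intro finprod_insert) auto
    also have "\<dots> = u a \<otimes>\<^bsub>Z2sq\<^esub> ((\<Sum>i\<in>A. fst (u i)) mod 2, (\<Sum>i\<in>A. snd (u i)) mod 2)"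
      using insert by simp
    finally show ?case using insert(1,2) by (simp add: mult_DirProd' mod_add_right_eq)
  qed simp
qed

lemma sum_bit_eq_0_iff: "(\<Sum>i\<in>A. of_nat (u i) :: bit) = 0 \<longleftrightarrow> even (\<Sum>i\<in>A. u i)"
  using of_nat_bit_eq_0_iff[of "\<Sum>i\<in>A. u i"] by simp

lemma even_sum_mod_2: "even (\<Sum>i\<in>A. u i mod 2 :: nat) \<longleftrightarrow> even (\<Sum>i\<in>A. u i)"
  by (metis even_iff_mod_2_eq_zero mod_sum_eq)

text \<open>Reading \<open>x\<close> as the pair of its high bit and its parity, the two equations
  are the two components of the group equation.\<close>

lemma iterated_group_Z2sq_std: "iterated_group n Z2sq (std_group_op n 0)"
proof -
  let ?\<phi> = "\<lambda>x. (int (l_half x), int (x mod 2))"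
  have bij: "bij_betw ?\<phi> Sigma4 (carrier Z2sq)"
    unfolding bij_betw_def
  proof
    show "inj_on ?\<phi> Sigma4" by (auto simp: inj_on_def Sigma4_def l_half_def)
    have "{0..<2::int} = {0, 1}" by auto
    then show "?\<phi> ` Sigma4 = carrier Z2sq"
      by (auto simp: carrier_integer_mod_group Sigma4_def l_half_def)
  qed
  then have "order Z2sq = 4"
    using bij_betw_same_card[OF bij] by (simp add: order_def card_Sigma4)
  moreover have "op_graph n (std_group_op n 0) x \<longleftrightarrow> finprod Z2sq (\<lambda>i. ?\<phi> (x i)) {0..n} = \<one>\<^bsub>Z2sq\<^esub>"
    if x: "x \<in> vecs {0..n}" for x
  proof -
    have "finprod Z2sq (\<lambda>i. ?\<phi> (x i)) {0..n} =
        ((\<Sum>i=0..n. int (l_half (x i))) mod 2, (\<Sum>i=0..n. int (x i mod 2)) mod 2)"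
      using bij_betw_apply[OF bij] PiE_mem[OF x] by (subst finprod_Z2sq) auto
    also have "\<dots> = (int ((\<Sum>i=0..n. l_half (x i)) mod 2), int ((\<Sum>i=0..n. x i mod 2) mod 2))"
      by (simp add: zmod_int)
    finally have "finprod Z2sq (\<lambda>i. ?\<phi> (x i)) {0..n} = \<one>\<^bsub>Z2sq\<^esub> \<longleftrightarrow>
        even (\<Sum>i=0..n. l_half (x i)) \<and> even (\<Sum>i=0..n. x i)"
      by (simp add: even_sum_mod_2 flip: even_iff_mod_2_eq_zero del: of_nat_mod)
    then show ?thesis
      unfolding op_graph_std_op[OF x] by (simp add: half_form_def hi_def lo_def sum_bit_eq_0_iff del: of_nat_sum)
  qed
  ultimately show ?thesis
    unfolding iterated_group_def using comm_group_Z2sq bij semi_form_std_op[of n "half_form 0"]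
    by (auto simp: semi_form_def simp del: carrier_DirProd one_DirProd)
qed

text \<open>With \<open>s\<close> the sum of the high bits and \<open>t\<close> that of the
  parities, 4 divides \<open>s + 2 * t\<close> iff \<open>s\<close> and \<open>t + s div 2\<close>
  are both even.\<close>

lemma iterated_group_Z4_std: "iterated_group n Z4 (std_group_op n 1)"
proof -
  let ?\<phi> = "\<lambda>x. int (l_half x + 2 * (x mod 2))"
  have bij: "bij_betw ?\<phi> Sigma4 (carrier Z4)"
    unfolding bij_betw_def
  proof
    show "inj_on ?\<phi> Sigma4" by (auto simp: inj_on_def Sigma4_def l_half_def)
    have "{0..<4::int} = {0, 1, 2, 3}" by auto
    then show "?\<phi> ` Sigma4 = carrier Z4"
      by (auto simp: carrier_integer_mod_group Sigma4_def l_half_def)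
  qed
  then have "order Z4 = 4"
    using bij_betw_same_card[OF bij] by (simp add: order_def card_Sigma4)
  moreover have "op_graph n (std_group_op n 1) x \<longleftrightarrow> finprod Z4 (\<lambda>i. ?\<phi> (x i)) {0..n} = \<one>\<^bsub>Z4\<^esub>"
    if x: "x \<in> vecs {0..n}" for x
  proof -
    define s where "s = (\<Sum>i=0..n. l_half (x i))"
    define t where "t = (\<Sum>i=0..n. x i mod 2)"
    let ?S = "{i \<in> {1..n}. hi (x i) = 1}"
    have "finprod Z4 (\<lambda>i. ?\<phi> (x i)) {0..n} = (\<Sum>i=0..n. ?\<phi> (x i)) mod 4"
      using bij_betw_apply[OF bij] PiE_mem[OF x] by (subst finprod_Z4) auto
    also have "(\<Sum>i=0..n. ?\<phi> (x i)) = int (s + 2 * t)"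
      by (simp add: s_def t_def sum.distrib sum_distrib_left)
    finally have fp: "finprod Z4 (\<lambda>i. ?\<phi> (x i)) {0..n} = \<one>\<^bsub>Z4\<^esub> \<longleftrightarrow> (s + 2 * t) mod 4 = 0"
      by simp presburger
    have "card ?S = (\<Sum>i=1..n. l_half (x i))"
    proof -
      have "(\<Sum>i=1..n. l_half (x i)) = (\<Sum>i=1..n. of_bool (hi (x i) = 1))"
        by (rule sum.cong) (auto simp: hi_def l_half_def)
      also have "\<dots> = card ({1..n} \<inter> {i. hi (x i) = 1})"
        by (subst sum_of_bool_eq) auto
      also have "{1..n} \<inter> {i. hi (x i) = 1} = ?S" by auto
      finally show ?thesis by simp
    qed
    then have s: "s = l_half (x 0) + card ?S"
      by (simp add: s_def sum.atLeast_Suc_atMost)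
    have half: "Suc (card ?S) div 2 = s div 2" if "even s"
      using that unfolding s l_half_def by (auto elim!: evenE oddE) 
    have "op_graph n (std_group_op n 1) x \<longleftrightarrow> even s \<and>
        (\<Sum>i=0..n. lo (x i)) = of_nat (Suc (card ?S) div 2)"
      unfolding op_graph_std_op[OF x] by (simp add: half_form_def hi_def s_def sum_bit_eq_0_iff del: of_nat_sum)
    also have "\<dots> \<longleftrightarrow> even s \<and> (\<Sum>i=0..n. lo (x i)) + of_nat (s div 2) = 0"
      by (rule conj_cong[OF refl]) (simp only: half bit_add_eq_0_iff)
    also have "(\<Sum>i=0..n. lo (x i)) + of_nat (s div 2) = of_nat ((\<Sum>i=0..n. x i) + s div 2)"
      by (simp add: lo_def)
    also have "\<dots> = 0 \<longleftrightarrow> even (t + s div 2)"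
      unfolding of_nat_bit_eq_0_iff even_add t_def even_sum_mod_2 ..
    also have "even s \<and> even (t + s div 2) \<longleftrightarrow> (s + 2 * t) mod 4 = 0"
      by presburger
    finally show ?thesis unfolding fp .
  qed
  ultimately show ?thesis
    unfolding iterated_group_def using bij semi_form_std_op[of n "half_form 1"]
    by (auto simp: semi_form_def)
qed

text \<open>Two identifications of \<open>Sigma4\<close> with the group differ by one permutation,
  applied in every coordinate.\<close>

lemma iterated_group_isotopic:
  assumes "iterated_group n G g" "iterated_group n G g'"
  shows "isotopic n g g'"
proof -
  obtain \<phi> where G: "comm_group G" and q: "quasigroup4 n g" and \<phi>: "bij_betw \<phi> Sigma4 (carrier G)"
    and gr: "\<And>x. x \<in> vecs {0..n} \<Longrightarrow> op_graph n g x \<longleftrightarrow> finprod G (\<lambda>i. \<phi> (x i)) {0..n} = \<one>\<^bsub>G\<^esub>"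
    using assms(1) unfolding iterated_group_def by blast
  obtain \<phi>' where q': "quasigroup4 n g'" and \<phi>': "bij_betw \<phi>' Sigma4 (carrier G)"
    and gr': "\<And>x. x \<in> vecs {0..n} \<Longrightarrow> op_graph n g' x \<longleftrightarrow> finprod G (\<lambda>i. \<phi>' (x i)) {0..n} = \<one>\<^bsub>G\<^esub>"
    using assms(2) unfolding iterated_group_def by blast
  interpret comm_group G by (rule G)
  define \<sigma> where "\<sigma> x = (if x \<in> Sigma4 then inv_into Sigma4 \<phi>' (\<phi> x) else x)" for x
  have "bij_betw (inv_into Sigma4 \<phi>' \<circ> \<phi>) Sigma4 Sigma4"
    by (rule bij_betw_trans[OF \<phi> bij_betw_inv_into[OF \<phi>']])
  then have "bij_betw \<sigma> Sigma4 Sigma4"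
    by (rule bij_betw_cong[THEN iffD1, rotated]) (simp add: \<sigma>_def)
  then have perm: "\<sigma> permutes Sigma4"
    by (rule bij_imp_permutes) (simp add: \<sigma>_def)
  have \<phi>\<sigma>: "\<phi>' (\<sigma> x) = \<phi> x" if "x \<in> Sigma4" for x
    using that bij_betw_inv_into_right[OF \<phi>' bij_betw_apply[OF \<phi> that]] by (simp add: \<sigma>_def)
  have "op_graph n g x \<longleftrightarrow> op_graph n g' (\<lambda>i. \<sigma> (x i))" if x: "x \<in> vecs {0..n}" for x
  proof -
    let ?y = "\<lambda>i\<in>{0..n}. \<sigma> (x i)"
    have y: "?y \<in> vecs {0..n}" by (rule restrict_permutes_in_vecs) (use perm x in auto)
    have "finprod G (\<lambda>i. \<phi>' (?y i)) {0..n} = finprod G (\<lambda>i. \<phi> (x i)) {0..n}"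
      by (rule finprod_cong') (use PiE_mem[OF x] bij_betw_apply[OF \<phi>] \<phi>\<sigma> in auto)
    then have "op_graph n g x \<longleftrightarrow> op_graph n g' ?y"
      unfolding gr[OF x] gr'[OF y] by simp
    also have "\<dots> \<longleftrightarrow> op_graph n g' (\<lambda>i. \<sigma> (x i))"
      by (rule op_graph_cong) simp
    finally show ?thesis .
  qed
  then show ?thesis
    unfolding isotopic_iff using q q' perm by (intro conjI exI[of _ "\<lambda>_. \<sigma>"]) auto
qed

lemma group_linear_imp_isotopic:
  "\<lbrakk>group_linear n G f; iterated_group n G g\<rbrakk> \<Longrightarrow> isotopic n f g"
  unfolding group_linear_def using iterated_group_isotopic isotopic_trans by blast

lemma isotopic_imp_obtained:
  assumes "isotopic n f g" "iterated_group n G g"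
  shows "obtained_from_iterated_group n G f"
proof -
  have "parastrophic n g g"
    unfolding parastrophic_def using assms(2)
    by (auto simp: iterated_group_def intro!: exI[of _ id] permutes_id)
  then show ?thesis
    unfolding obtained_from_iterated_group_def using assms by blast
qed

lemma balanced_rows_half_form_0: "balanced_rows n (half_form 0) = upper_cols n"
  by (auto simp: balanced_rows_def row_vals_def half_form_def even_cols_def ones_def)

text \<open>Each column has two ones, so the row sizes add up to \<open>2 * n\<close>. Two of them
  are odd, so the halves rounded up add up to \<open>n + 1\<close>, which is even for odd
  \<open>n\<close>.\<close>

lemma balanced_rows_half_form_1:
  assumes "odd n"
  shows "balanced_rows n (half_form 1) = upper_cols n"
proof -
  have "row_vals n (half_form 1) U \<in> even_cols" if U: "U \<in> upper_cols n" for U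
  proof -
    define r where "r i = card (row_set n U i)" for i
    have r: "r i = (\<Sum>k=1..n. of_bool (pr i (U k) = 1))" for i
    proof -
      have "row_set n U i = {1..n} \<inter> {k. pr i (U k) = 1}" by (auto simp: row_set_def)
      then show ?thesis by (simp add: r_def)
    qed
    have bitr: "of_nat (r i) = hi i" if i: "i \<in> Sigma4" for i
    proof -
      have "of_nat (r i) = (\<Sum>k=1..n. pr i (U k))"
        unfolding r of_nat_sum by (rule sum.cong) auto
      also have "\<dots> = pr i (\<Sum>k=1..n. U k)" by (simp add: pr_sum[OF i])
      also have "\<dots> = hi i" using U by (simp add: sum_solutions_def pr_hi[OF i])
      finally show ?thesis .
    qed
    have par: "even (r 0)" "even (r 1)" "odd (r 2)" "odd (r 3)"
      using bitr[of 0] bitr[of 1] bitr[of 2] bitr[of 3] of_nat_bit_eq_0_iff[of "r 0"]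
        of_nat_bit_eq_0_iff[of "r 1"] of_nat_bit_eq_0_iff[of "r 2"] of_nat_bit_eq_0_iff[of "r 3"]
      by (auto simp: Sigma4_def hi_def l_half_def)
    have "r 0 + r 1 + r 2 + r 3 = (\<Sum>k=1..n. 2)"
      unfolding r sum.distrib[symmetric]
    proof (rule sum.cong)
      fix k assume "k \<in> {1..n}"
      then have "U k \<in> bal" using U PiE_mem[of U "{1..n}" "\<lambda>_. bal" k] by (auto simp: sum_solutions_def)
      then show "of_bool (pr 0 (U k) = 1) + of_bool (pr 1 (U k) = 1) + of_bool (pr 2 (U k) = 1)
          + of_bool (pr 3 (U k) = 1) = (2::nat)"
        by (elim bal_cases) simp_all
    qed simp
    then have "Suc (r 0) div 2 + Suc (r 1) div 2 + Suc (r 2) div 2 + Suc (r 3) div 2 = n + 1"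
      using par by (auto elim!: evenE oddE)
    then have "(of_nat (Suc (r 0) div 2 + Suc (r 1) div 2 + Suc (r 2) div 2 + Suc (r 3) div 2) :: bit) = 0"
      unfolding of_nat_bit_eq_0_iff using assms by simp
    then show ?thesis
      by (simp add: even_cols_def ones_def row_vals_def half_form_def r_def)
  qed
  then show ?thesis by (auto simp: balanced_rows_def)
qed

subsection \<open>The maximum and its uniqueness\<close>

definition max_count :: "nat \<Rightarrow> nat" where
  "max_count n = num_transversals n (std_group_op n 0)"

text \<open>The count grows strictly with the size of \<open>balanced_rows n L\<close>, a subset of
  \<open>upper_cols n\<close> that is everything for \<open>L = 0\<close>.\<close>

lemma
  assumes "semi_form n L f" "n \<ge> 1"
  shows num_transversals_le_max_count: "num_transversals n f \<le> max_count n"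
    and num_transversals_eq_max_count_iff: "num_transversals n f = max_count n \<longleftrightarrow> balanced_rows n L = upper_cols n"
proof -
  have max: "8 * max_count n = 4 ^ n * (card (upper_cols n) + card (const_cols n))"
    unfolding max_count_def num_transversals_semi_form[OF semi_form_std_op assms(2)]
      balanced_rows_half_form_0 ..
  note num = num_transversals_semi_form[OF assms]
  have sub: "balanced_rows n L \<subseteq> upper_cols n" by (auto simp: balanced_rows_def)
  have le: "card (balanced_rows n L) \<le> card (upper_cols n)"
    by (rule card_mono[OF finite_upper_cols sub])
  then have "8 * num_transversals n f \<le> 8 * max_count n"
    unfolding num max by simp
  then show "num_transversals n f \<le> max_count n" by simp
  have "num_transversals n f = max_count n \<longleftrightarrow> 8 * num_transversals n f = 8 * max_count n" by simp
  also have "\<dots> \<longleftrightarrow> card (balanced_rows n L) = card (upper_cols n)"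
    unfolding num max by simp
  also have "\<dots> \<longleftrightarrow> balanced_rows n L = upper_cols n"
    using card_subset_eq[OF finite_upper_cols sub] by auto
  finally show "num_transversals n f = max_count n \<longleftrightarrow> balanced_rows n L = upper_cols n" .
qed

text \<open>For odd \<open>n\<close>, \<open>- ((- 2) ^ n)\<close> yields one \<open>8 ^ n\<close>
  and the constant columns yield four more, hence the 5; for even \<open>n\<close> only
  \<open>- (8 ^ n)\<close> is left.\<close>

lemma max_count_formula:
  assumes "n \<ge> 1"
  shows "real (max_count n) = 3 / 8 * 24 ^ (n - 1) + (if odd n then 5 else - 1) * 8 powi (int n - 2)"
proof -
  have "8 * int (max_count n) = 4 ^ n * (int (card (upper_cols n)) + int (card (const_cols n)))"
  proof -
    have "8 * max_count n = 4 ^ n * (card (upper_cols n) + card (const_cols n))"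
      unfolding max_count_def num_transversals_semi_form[OF semi_form_std_op assms]
        balanced_rows_half_form_0 ..
    from arg_cong[OF this, of int] show ?thesis by simp
  qed
  then have "64 * int (max_count n) = 4 ^ n * (8 * int (card (upper_cols n)) + 4 * (2 * int (card (const_cols n))))"
    by (simp add: algebra_simps)
  moreover have "8 * int (card (upper_cols n)) = 6 ^ n - (- 2) ^ n"
    using card_bal_solutions[OF assms, of "(0,0,1,1)"] by (simp add: ones_def zero_prod_def bal_def)
  moreover have "2 * int (card (const_cols n)) = 2 ^ n * of_bool (odd n)"
  proof -
    have "2 * card (const_cols n) = 2 ^ n * of_bool (odd n)"
      using card_const_solutions[OF assms, of "(0,0,1,1)"]
      by (simp add: const_cols_def ones_def zero_prod_def)
    from arg_cong[OF this, of int] show ?thesis by simp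
  qed
  ultimately have "64 * int (max_count n) = 4 ^ n * (6 ^ n - (- 2) ^ n + 4 * (2 ^ n * of_bool (odd n)))"
    by simp
  from arg_cong[OF this, of real_of_int]
  have eq: "64 * real (max_count n) = 4 ^ n * (6 ^ n - (- 2) ^ n + 4 * (2 ^ n * of_bool (odd n)))"
    by simp
  obtain m where m: "n = Suc m" using assms by (cases n) auto
  have p24: "(4::real) ^ n * 6 ^ n = 24 ^ n" and p8: "(4::real) ^ n * 2 ^ n = 8 ^ n"
    and p8': "(2::real) ^ n * 4 ^ n = 8 ^ n"
    by (simp_all flip: power_mult_distrib)
  \<comment> \<open>The exponent is negative for \<open>n = 1\<close>, hence the integer
    power.\<close>
  have powi: "(8::real) powi (int n - 2) = 8 ^ n / 64"
    by (simp add: power_int_diff)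
  show ?thesis
  proof (cases "odd n")
    case True
    then have "64 * real (max_count n) = 24 ^ n + 5 * 8 ^ n"
      using eq by (simp add: algebra_simps p24 p8 p8')
    then show ?thesis using True unfolding powi by (simp add: m)
  next
    case False
    then have "64 * real (max_count n) = 24 ^ n - 8 ^ n"
      using eq by (simp add: algebra_simps p24 p8 p8')
    then show ?thesis using False unfolding powi by (simp add: m)
  qed
qed

lemma num_transversals_group_linear:
  assumes "n \<ge> 1" "group_linear n Z2sq f \<or> odd n \<and> group_linear n Z4 f"
  shows "num_transversals n f = max_count n" "semilinear n f"
proof -
  have "num_transversals n f = max_count n \<and> semilinear n f"
    using assms(2)
  proof (elim disjE conjE)
    assume "group_linear n Z2sq f"
    then have iso: "isotopic n f (std_group_op n 0)"
      using group_linear_imp_isotopic iterated_group_Z2sq_std by blast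
    then show ?thesis
      using semi_form_std_op num_transversals_isotopic[OF iso]
      unfolding semilinear_def standardly_semilinear_iff max_count_def by blast
  next
    assume "odd n" "group_linear n Z4 f"
    then have iso: "isotopic n f (std_group_op n 1)"
      using group_linear_imp_isotopic iterated_group_Z4_std by blast
    have "num_transversals n (std_group_op n 1) = max_count n"
      using num_transversals_eq_max_count_iff[OF semi_form_std_op assms(1)]
        balanced_rows_half_form_1[OF \<open>odd n\<close>] by blast
    then show ?thesis
      using semi_form_std_op iso num_transversals_isotopic[OF iso]
      unfolding semilinear_def standardly_semilinear_iff by auto
  qed
  then show "num_transversals n f = max_count n" "semilinear n f" by auto
qed

lemma semilinear_num_transversals_le:
  assumes "n \<ge> 1" "semilinear n h"
  shows "num_transversals n h \<le> max_count n"
  using assms num_transversals_isotopic num_transversals_le_max_count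
  unfolding semilinear_def standardly_semilinear_iff by metis

lemma max_among_semilinear_imp_obtained:
  assumes "n \<ge> 1" "max_among_semilinear n f"
  shows "obtained_from_iterated_group n Z2sq f \<or> (odd n \<and> obtained_from_iterated_group n Z4 f)"
proof -
  obtain g L where g: "semi_form n L g" and iso: "isotopic n f g"
    using assms(2) unfolding max_among_semilinear_def semilinear_def standardly_semilinear_iff by blast
  \<comment> \<open>The quasigroup with \<open>L = 0\<close> is a semilinear competitor, so a
    maximal \<open>f\<close> reaches \<open>max_count n\<close>.\<close>
  have "isotopic n (std_group_op n 0) (std_group_op n 0)"
    using iterated_group_isotopic iterated_group_Z2sq_std by blast
  then have "semilinear n (std_group_op n 0)"
    unfolding semilinear_def standardly_semilinear_iff using semi_form_std_op by blast
  then have "max_count n \<le> num_transversals n f"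
    using assms(2) by (simp add: max_among_semilinear_def max_count_def)
  then have "num_transversals n g = max_count n"
    using num_transversals_isotopic[OF iso] num_transversals_le_max_count[OF g assms(1)] by simp
  then have "balanced_rows n L = upper_cols n"
    using num_transversals_eq_max_count_iff[OF g assms(1)] by simp
  then obtain c0 a c where L: "\<And>S. S \<subseteq> {1..n} \<Longrightarrow> L S = c0 + (\<Sum>i\<in>S. a i) + c * of_nat (card S div 2)"
    and c: "even n \<Longrightarrow> c = 0"
    using balanced_rows_imp_quadratic[OF _ assms(1)] by metis
  have iso': "isotopic n f (std_group_op n c)"
    by (rule isotopic_trans[OF iso quadratic_isotopic_std[OF g L]])
  show ?thesis
  proof (cases c)
    case zero
    then show ?thesis using isotopic_imp_obtained[OF iso'[unfolded zero] iterated_group_Z2sq_std] by blast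
  next
    case one
    then have "odd n" using c by auto
    then show ?thesis using isotopic_imp_obtained[OF iso'[unfolded one] iterated_group_Z4_std] by blast
  qed
qed

theorem theorem10:
  fixes n :: nat
  assumes "n \<ge> 1"
  shows
    "(odd n \<longrightarrow> (\<forall>f. group_linear n Z2sq f \<or> group_linear n Z4 f \<longrightarrow>
        real (num_transversals n f) = 3 / 8 * 24 ^ (n - 1) + 5 * 8 powi (int n - 2))) \<and>
     (even n \<longrightarrow> (\<forall>f. group_linear n Z2sq f \<longrightarrow>
        real (num_transversals n f) = 3 / 8 * 24 ^ (n - 1) - 8 powi (int n - 2))) \<and>
     (\<forall>f. group_linear n Z2sq f \<or> (odd n \<and> group_linear n Z4 f) \<longrightarrow>
        max_among_semilinear n f) \<and>
     (\<forall>f. max_among_semilinear n f \<longrightarrow>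
        obtained_from_iterated_group n Z2sq f \<or>
        (odd n \<and> obtained_from_iterated_group n Z4 f))"
proof (intro conjI allI impI)
  fix f
  assume "odd n" "group_linear n Z2sq f \<or> group_linear n Z4 f"
  then have "num_transversals n f = max_count n"
    using num_transversals_group_linear(1)[OF assms] by blast
  then show "real (num_transversals n f) = 3 / 8 * 24 ^ (n - 1) + 5 * 8 powi (int n - 2)"
    using max_count_formula[OF assms] \<open>odd n\<close> by simp
next
  fix f
  assume "even n" "group_linear n Z2sq f"
  then have "num_transversals n f = max_count n"
    using num_transversals_group_linear(1)[OF assms] by blast
  then show "real (num_transversals n f) = 3 / 8 * 24 ^ (n - 1) - 8 powi (int n - 2)"
    using max_count_formula[OF assms] \<open>even n\<close> by simp
next
  fix f
  assume "group_linear n Z2sq f \<or> odd n \<and> group_linear n Z4 f"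
  then show "max_among_semilinear n f"
    unfolding max_among_semilinear_def
    using num_transversals_group_linear[OF assms] semilinear_num_transversals_le[OF assms] by metis
next
  fix f
  assume "max_among_semilinear n f"
  then show "obtained_from_iterated_group n Z2sq f \<or> odd n \<and> obtained_from_iterated_group n Z4 f"
    by (rule max_among_semilinear_imp_obtained[OF assms])
qed

end
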